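(* For every integer $d\ge 2$ there exists a (sufficiently large) constant $t$ such that the following claims hold for every $\varepsilon>0$. (a) For every $A>0$ there is a constant $b>0$ such that for all positive integers $n,m$ with $m\le A n^d$ there exist a set $\mathcal P$ of $m$ points and a set $\mathcal H$ of $n$ hyperplanes, both in $\mathbb R^d$, such that the incidence graph of $\mathcal P\times\mathcal H$ contains no $K_{2,t+1}$ and $$I(\mathcal P,\mathcal H)\ge b\left(m^{\frac{2d-2}{2d-1}}n^{\frac{d}{2d-1}-\varepsilon}+m+n\right).$$ (b) Suppose $d\ge 4$. For every $A>0$ there is a constant $b>0$ such that for all positive integers $n,m$ with $m\le A n^{d-2}$ there exist a set $\mathcal P$ of $m$ points and a set $\mathcal H$ of $n$ hyperplanes, both in $\mathbb R^d$, such that the incidence graph of $\mathcal P\times\mathcal H$ contains no $K_{3,t+1}$ and $$I(\mathcal P,\mathcal H)\ge b\left(m^{\frac{3d^2-9d+2}{(d-2)(3d-1)}}n^{\frac{2d}{3d-1}-\varepsilon}+m+n\right).$$ Here the constants $b$ may depend on $d,t,\varepsilon,A$, but not on $m,n$.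
   Context: $I(\mathcal P,\mathcal H)$ is the number of pairs $(p,h)\in\mathcal P\times\mathcal H$ with $p\in h$. The incidence graph is the bipartite graph on $\mathcal P,\mathcal H$ with an edge for each such pair; it contains no $K_{a,b'}$ if there are no $a$ distinct points of $\mathcal P$ all contained in each of $b'$ distinct hyperplanes of $\mathcal H$. Hyperplanes are affine. *)

theory Defs
  imports "HOL-Analysis.Analysis"
begin

text \<open>Affine hyperplanes need not pass through the origin.\<close>

definition hyperplane :: "'a::euclidean_space set \<Rightarrow> bool" where
  "hyperplane h \<longleftrightarrow> (\<exists>a c. a \<noteq> 0 \<and> h = {x. a \<bullet> x = c})"

text \<open>The edge set of the incidence graph, whose two vertex classes are \<open>P\<close> and \<open>H\<close>.\<close>

definition incidences :: "'a set \<Rightarrow> 'a set set \<Rightarrow> ('a \<times> 'a set) set" where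
  "incidences P H = {(p, h). p \<in> P \<and> h \<in> H \<and> p \<in> h}"

definition num_incidences :: "'a set \<Rightarrow> 'a set set \<Rightarrow> nat" where
  "num_incidences P H = card (incidences P H)"

text \<open>The copy of \<open>K\<^bsub>a,b\<^esub>\<close> is oriented: the \<open>a\<close>-side consists of points, the \<open>b\<close>-side of hyperplanes.\<close>

definition contains_K :: "nat \<Rightarrow> nat \<Rightarrow> 'a set \<Rightarrow> 'a set set \<Rightarrow> bool" where
  "contains_K a b P H \<longleftrightarrow>
     (\<exists>S T. S \<subseteq> P \<and> finite S \<and> card S = a \<and>
            T \<subseteq> H \<and> finite T \<and> card T = b \<and>
            S \<times> T \<subseteq> incidences P H)"

end

(*
  Fix a coordinate k and write points as (x, y) with y = x_k.  Over a set X of lattice points x in [M]^(d-1)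
  take all y < d N M, and take all hyperplanes y = <a, x> + b with b < N M and a in a set S of lattice
  points in [N]^(d-1).  Every hyperplane then contains a point over each x in X, and since a determines b,
  the hyperplanes through several given points correspond to the elements of S on the affine flat cut out
  by the equations <a, x - x'> = y - y'.

  (a) X is the full grid and S is the moment curve (s, s^2, ..., s^(d-1)) mod p for a prime p with
  N^(1 - eps) << p <= 2N, which meets every hyperplane in at most d - 1 points.
  (b) X lies on a sphere, so no three of its points are collinear and three points of the configuration
  force a into a flat of codimension 2; S is a set of about N^(2 - 4/((d-1)(d-2))) lattice points with
  boundedly many points on each such flat, found by the deletion method.

  In both cases m = N M^e and n = N^kappa M up to constants, with (e, kappa) = (d, 2) in (a) and
  (d - 2, 3 - 4/((d-1)(d-2))) in (b); solving for N and M gives the exponents.  If N or M comes out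
  below 1, the terms m + n dominate.
*)
theory Submission
  imports Defs "HOL-Computational_Algebra.Primes" "HOL-Computational_Algebra.Polynomial"
begin

text \<open>In both parts \<open>t\<close> is fixed before \<epsilon>, so the multiplicity bounds
  may not degrade with \<epsilon>. In (a), unreduced powers in a grid of side N would leave only
  about N^(1/(d-1)) points; reduction mod p makes room for p of them, and since a polynomial of
  degree d - 1 has at most d - 1 roots mod p, the multiplicity is the same at every scale. The loss
  \<epsilon> pays for the gap between p and N. In (b), a flat of codimension 2 may contain N^(d-3)
  of the N^(d-1) grid points, so the random set of slopes is taken thinner than N^2; size
  N^(2-\<delta>) is reached with t of order d^2/\<delta>, so \<delta> is held fixed, and
  4/((d-1)(d-2)) is the value that produces the stated exponents. Restricting to a sphere divides
  the number of base points by about M^2, the number of values of <x, x>, which turns e = d into e =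
  d - 2. Exact cardinalities are reached by letting each block use at most half of the points and of
  the hyperplanes; the rest is spent on padding, whose (m + n)/4 incidences supply the linear
  terms.\<close>

section \<open>Primes at every scale\<close>

text \<open>The reciprocals \<open>1 / (m * (n choose m))\<close> form Leibniz' harmonic triangle, in which
  each entry is a difference of two entries with smaller \<open>m\<close>.\<close>
lemma mult_binomial_dvd:
  fixes W :: nat
  assumes "\<And>j. 1 \<le> j \<Longrightarrow> j \<le> N \<Longrightarrow> j dvd W" and "1 \<le> m" "m \<le> n" "n \<le> N"
  shows "m * (n choose m) dvd W"
  using assms(2-4)
proof (induction m arbitrary: n rule: nat_induct_at_least)
  case base
  then show ?case using assms(1)[of n] by simp
next
  case (Suc m)
  obtain n' where n: "n = Suc n'" "m \<le> n'" using Suc.prems by (cases n) auto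
  have "m * (n' choose m) dvd W" using Suc.IH[of n'] Suc.prems n by simp
  then obtain r where r: "W = m * (n' choose m) * r" by (rule dvdE)
  have "m * (n choose m) dvd W" using Suc.IH[of n] Suc.prems n by simp
  then obtain s where s: "W = m * (n choose m) * s" by (rule dvdE)
  have e1: "int (Suc m * (n choose Suc m)) = int n * int (n' choose m)"
    using Suc_times_binomial[of m n'] n by (metis of_nat_mult)
  have "(n - m) * (n choose m) = n * (n' choose m)"
    using binomial_absorb_comp[of n m] n by simp
  hence e2: "(int n - int m) * int (n choose m) = int n * int (n' choose m)"
    using n by (metis Suc.prems(1) Suc_leD of_nat_diff of_nat_mult)
  \<comment> \<open>Multiplying 1/((m+1) C(n,m+1)) = 1/(m C(n-1,m)) - 1/(m C(n,m)) by
    \<open>W\<close> shows that the quotient sought is \<open>r - s\<close>.\<close>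
  have "int m * (int n * int (n' choose m) * (int r - int s)) 
      = int n * int W - int m * ((int n - int m) * int (n choose m)) * int s"
    unfolding e2 by (simp add: r algebra_simps)
  also have "\<dots> = int m * int W"
    by (simp add: s algebra_simps)
  finally have "int n * int (n' choose m) * (int r - int s) = int W"
    using Suc.hyps by simp
  hence "int (Suc m * (n choose Suc m)) dvd int W"
    unfolding e1 by (metis dvd_triv_left)
  then show ?case by (simp only: of_nat_dvd_iff)
qed

text \<open>This is lcm(1, ..., n), written with one factor per prime so that each factor is visibly
  at most \<open>n\<close> and the number of primes becomes the exponent of an upper bound.\<close>

definition common_multiple :: "nat \<Rightarrow> nat" where
  "common_multiple n = (\<Prod>p\<in>{p. prime p \<and> p \<le> n}. p ^ (GREATEST e. p ^ e \<le> n))"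

lemma power_Greatest:
  fixes p n :: nat
  assumes "2 \<le> p" "1 \<le> n"
  shows "p ^ (GREATEST e. p ^ e \<le> n) \<le> n" "p ^ e \<le> n \<Longrightarrow> e \<le> (GREATEST e. p ^ e \<le> n)"
proof -
  have b: "\<forall>e. p ^ e \<le> n \<longrightarrow> e \<le> n"
  proof (intro allI impI)
    fix e assume "p ^ e \<le> n"
    moreover have "e < p ^ e" using power_gt_expt[of p e] assms by simp
    ultimately show "e \<le> n" by linarith
  qed
  show "p ^ (GREATEST e. p ^ e \<le> n) \<le> n"
    by (rule GreatestI_nat[where P = "\<lambda>e. p ^ e \<le> n" and k = 0 and b = n]) (use assms b in auto)
  show "p ^ e \<le> n \<Longrightarrow> e \<le> (GREATEST e. p ^ e \<le> n)"
    by (rule Greatest_le_nat[where P = "\<lambda>e. p ^ e \<le> n" and b = n]) (use b in auto)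
qed

lemma dvd_common_multiple:
  assumes "1 \<le> j" "j \<le> n"
  shows "j dvd common_multiple n"
proof -
  have "(\<Prod>p\<in>prime_factors j. p ^ multiplicity p j) dvd
        (\<Prod>p\<in>prime_factors j. p ^ (GREATEST e. p ^ e \<le> n))"
  proof (rule prod_dvd_prod)
    fix p assume p: "p \<in> prime_factors j"
    have "p ^ multiplicity p j \<le> n"
      using dvd_imp_le[OF multiplicity_dvd[of p j]] assms by linarith
    thus "p ^ multiplicity p j dvd p ^ (GREATEST e. p ^ e \<le> n)"
    proof (intro le_imp_power_dvd power_Greatest(2))
      show "2 \<le> p" using p by (intro prime_ge_2_nat in_prime_factors_imp_prime)
    qed (use assms in auto)
  qed
  also have "\<dots> dvd common_multiple n"
    unfolding common_multiple_def
  proof (intro prod_dvd_prod_subset)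
    show "finite {p. prime p \<and> p \<le> n}" by (rule finite_subset[of _ "{..n}"]) auto
    show "prime_factors j \<subseteq> {p. prime p \<and> p \<le> n}"
    proof
      fix p assume "p \<in> prime_factors j"
      hence "prime p" "p \<le> j" using assms dvd_imp_le[of p j] by (auto simp: in_prime_factors_iff)
      thus "p \<in> {p. prime p \<and> p \<le> n}" using assms by simp
    qed
  qed
  finally have *: "(\<Prod>p\<in>prime_factors j. p ^ multiplicity p j) dvd common_multiple n" .
  have "j = (\<Prod>p\<in>prime_factors j. p ^ multiplicity p j)"
    using assms by (intro prime_factorization_nat) simp
  thus ?thesis by (rule ssubst) (rule *)
qed

text \<open>A Chebyshev-type bound by squeezing lcm(1, ..., 2N): it is a multiple of N C(2N,N),
  hence at least 2^N, while each of its prime power factors is at most 2N.\<close>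

lemma two_power_le_primes:
  assumes "1 \<le> N"
  shows "2 ^ N \<le> (2 * N) ^ card {p. prime p \<and> p \<le> 2 * N}"
proof -
  have pos: "common_multiple (2 * N) > 0"
    unfolding common_multiple_def by (intro prod_pos) (auto simp: prime_gt_0_nat)
  have "N * (2 * N choose N) dvd common_multiple (2 * N)"
    using assms by (intro mult_binomial_dvd[of "2 * N"] dvd_common_multiple) auto
  hence "N * (2 * N choose N) \<le> common_multiple (2 * N)"
    using pos dvd_imp_le by blast
  moreover have "2 ^ N \<le> 2 * N choose N"
  proof -
    have "(real (2 * N) / real N) ^ N \<le> real (2 * N choose N)"
      by (rule binomial_ge_n_over_k_pow_k) simp
    hence "real (2 ^ N) \<le> real (2 * N choose N)" using assms by simp
    thus ?thesis by (simp only: of_nat_le_iff)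
  qed
  moreover have "common_multiple (2 * N) \<le> (\<Prod>p\<in>{p. prime p \<and> p \<le> 2 * N}. 2 * N)"
    unfolding common_multiple_def
    using assms power_Greatest(1)[of _ "2 * N"] prime_ge_2_nat by (intro prod_mono) auto
  moreover have "2 * N choose N \<le> N * (2 * N choose N)" using assms by simp
  ultimately have "2 ^ N \<le> (\<Prod>p\<in>{p. prime p \<and> p \<le> 2 * N}. 2 * N)"
    by linarith
  thus ?thesis by (simp only: prod_constant)
qed

text \<open>The largest prime p up to 2N is at least the number of such primes, which is at least N
  ln 2 / ln(2N). The bound ln(2N) <= (2N)^\<epsilon>/\<epsilon> turns the logarithm into the
  permitted power loss and yields the constant.\<close>

lemma exists_prime_powr:
  fixes \<epsilon> :: real
  assumes "\<epsilon> > 0"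
  obtains c :: real where "c > 0"
    "\<And>N. 1 \<le> N \<Longrightarrow> \<exists>p. prime p \<and> c * real N powr (1 - \<epsilon>) \<le> real p \<and> p \<le> 2 * N"
proof
  show "\<epsilon> * ln 2 / 2 powr \<epsilon> > 0" using assms by simp
  fix N :: nat assume N: "1 \<le> N"
  let ?S = "{p. prime p \<and> p \<le> 2 * N}"
  have fin: "finite ?S" by (rule finite_subset[of _ "{..2 * N}"]) auto
  have ne: "2 \<in> ?S" using N by simp
  define p where "p = Max ?S"
  have p: "p \<in> ?S" using Max_in[OF fin] ne unfolding p_def by blast
  have "?S \<subseteq> {1..p}" 
  proof
    fix q assume "q \<in> ?S"
    thus "q \<in> {1..p}" using Max_ge[OF fin, of q] prime_ge_1_nat[of q] by (auto simp: p_def)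
  qed
  hence card: "card ?S \<le> p" using card_mono[of "{1..p}" ?S] by simp
  have "real N * ln 2 = ln (real (2 ^ N))" by (simp add: ln_realpow)
  also have "\<dots> \<le> ln (real ((2 * N) ^ card ?S))"
  proof (subst ln_le_cancel_iff)
    show "real (2 ^ N) \<le> real ((2 * N) ^ card ?S)"
      using two_power_le_primes[OF N] by (simp only: of_nat_le_iff)
  qed (use N in auto)
  also have "\<dots> = real (card ?S) * ln (real (2 * N))"
    unfolding of_nat_power by (rule ln_realpow)
  also have "\<dots> \<le> real p * ln (real (2 * N))" using N card by (intro mult_right_mono) auto
  also have "\<dots> \<le> real p * (real (2 * N) powr \<epsilon> / \<epsilon>)"
    using ln_powr_bound[of "real (2*N)" \<epsilon>] assms N by (intro mult_left_mono) auto
  finally have "real N * ln 2 * \<epsilon> \<le> real p * (2 powr \<epsilon> * real N powr \<epsilon>)"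
    using assms N by (simp add: field_simps powr_mult)
  hence "\<epsilon> * ln 2 / 2 powr \<epsilon> * (real N / real N powr \<epsilon>) \<le> real p"
    using N by (simp add: field_simps)
  hence "\<epsilon> * ln 2 / 2 powr \<epsilon> * real N powr (1 - \<epsilon>) \<le> real p"
    using N by (simp add: powr_diff)
  thus "\<exists>p. prime p \<and> \<epsilon> * ln 2 / 2 powr \<epsilon> * real N powr (1 - \<epsilon>) \<le> real p \<and> p \<le> 2 * N"
    using p by blast
qed

section \<open>Hyperplane sections of the moment curve modulo a prime\<close>

lemma const_dvd_const:
  fixes a b :: "'a::comm_ring_1"
  assumes "a dvd b"
  shows "[:a:] dvd [:b:]"
proof -
  obtain k where "b = a * k" using assms by (rule dvdE)
  hence "[:b:] = [:a:] * [:k:]" by simp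
  thus ?thesis by (rule dvdI)
qed

text \<open>Lagrange's bound over the field with p elements. Nontriviality is expressed by
  divisibility of all coefficients, not by the degree of the reduction, because this form passes
  from \<open>f\<close> to the cofactor \<open>g\<close> of a linear factor: if p divided
  \<open>g\<close>, it would divide \<open>f\<close> too, since it divides the remainder
  f(r).\<close>

lemma card_roots_mod_prime:
  fixes f :: "int poly" and p :: nat
  assumes "prime p" and "\<not> [:int p:] dvd f"
  shows "card {s. s < p \<and> int p dvd poly f (int s)} \<le> degree f"
  using assms(2)
proof (induction "degree f" arbitrary: f)
  case 0
  then obtain c where f: "f = [:c:]" by (metis degree_eq_zeroE)
  hence "\<not> int p dvd c" using 0 const_dvd_const by blast
  thus ?case using f by simp
next
  case (Suc n)
  let ?Z = "\<lambda>f. {s. s < p \<and> int p dvd poly f (int s)}"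
  show ?case
  proof (cases "?Z f = {}")
    case True
    then show ?thesis by (simp only: card.empty)
  next
    case False
    then obtain r where r: "r < p" "int p dvd poly f (int r)" by blast
    define g where "g = synthetic_div f (int r)"
    have f: "f = [:- int r, 1:] * g + [:poly f (int r):]"
      using synthetic_div_correct'[of "int r" f] by (simp add: g_def)
    have deg: "degree g = n" using Suc(2) by (simp add: g_def degree_synthetic_div)
    have "\<not> [:int p:] dvd g"
    proof
      assume "[:int p:] dvd g"
      hence "[:int p:] dvd [:- int r, 1:] * g + [:poly f (int r):]"
        using r const_dvd_const by (intro dvd_add dvd_mult) auto
      thus False using f Suc.prems by simp
    qed
    hence IH: "card (?Z g) \<le> n" using Suc.hyps(1)[of g] deg by simp
    have "?Z f \<subseteq> insert r (?Z g)"
    proof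
      fix s assume s: "s \<in> ?Z f"
      have "poly f (int s) = (int s - int r) * poly g (int s) + poly f (int r)"
        by (subst f) (simp add: algebra_simps)
      hence "int p dvd (int s - int r) * poly g (int s)"
        using s r by (simp add: dvd_add_left_iff)
      hence "int p dvd int s - int r \<or> int p dvd poly g (int s)"
        using assms(1) by (simp add: prime_dvd_mult_iff)
      moreover have "s = r" if "int p dvd int s - int r"
        using that s r zdvd_imp_le[of "int p" "int s - int r"] zdvd_imp_le[of "int p" "int r - int s"]
        by (cases s r rule: linorder_cases) (auto simp: dvd_diff_commute)
      ultimately show "s \<in> insert r (?Z g)" using s by auto
    qed
    hence "card (?Z f) \<le> card (insert r (?Z g))" by (intro card_mono) auto
    also have "\<dots> \<le> Suc n" using IH by (simp add: card_insert_if)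
    finally show ?thesis using Suc(2) by simp
  qed
qed

text \<open>Dividing \<open>u\<close> by its content first makes the reduction modulo \<open>p\<close> nontrivial.\<close>
lemma card_moment_curve_hyperplane:
  fixes u :: "'i \<Rightarrow> int" and e :: "'i \<Rightarrow> nat" and p :: nat
  assumes "prime p" "finite I" and e: "inj_on e I" "e ` I \<subseteq> {1..D}"
    and "\<exists>i\<in>I. u i \<noteq> 0"
  shows "card {s. s < p \<and> (\<Sum>i\<in>I. int (s ^ e i mod p) * u i) = v} \<le> D"
proof (cases "Gcd (u ` I) dvd v")
  case False
  have "Gcd (u ` I) dvd (\<Sum>i\<in>I. int (s ^ e i mod p) * u i)" for s
    by (intro dvd_sum dvd_mult Gcd_dvd) auto
  hence "{s. s < p \<and> (\<Sum>i\<in>I. int (s ^ e i mod p) * u i) = v} = {}" using False by blast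
  then show ?thesis by (simp only: card.empty)
next
  case True
  define g where "g = Gcd (u ` I)"
  have g0: "g \<noteq> 0" using assms by (auto simp: g_def Gcd_0_iff)
  define w where "w i = u i div g" for i
  have u: "u i = g * w i" if "i \<in> I" for i
    using that Gcd_dvd[of "u i" "u ` I"] by (simp add: w_def g_def)
  obtain v' where v: "v = g * v'" using True by (auto simp: g_def)
  \<comment> \<open>The equation divided by its content, evaluated along the unreduced curve.
    Distinct positive exponents keep the coefficients \<open>w i\<close> apart from each other and
    from the constant term.\<close>
  define f where "f = (\<Sum>i\<in>I. monom (w i) (e i)) - [:v':]"
  have coeff: "coeff f (e j) = w j" if "j \<in> I" for j
  proof -
    have "coeff f (e j) = (\<Sum>i\<in>I. if e i = e j then w i else 0) - coeff [:v':] (e j)"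
      by (simp add: f_def coeff_sum)
    also have "coeff [:v':] (e j) = 0" using that e by (cases "e j") (auto simp: image_subset_iff)
    also have "(\<Sum>i\<in>I. if e i = e j then w i else 0) = (\<Sum>i\<in>I. if i = j then w i else 0)"
      using e(1) that by (intro sum.cong) (auto dest: inj_onD)
    finally show ?thesis using that assms(2) by simp
  qed
  have deg: "degree f \<le> D" unfolding f_def
    using e by (intro degree_diff_le degree_sum_le order_trans[OF degree_monom_le]) (auto simp: assms(2))
  \<comment> \<open>If p divided every \<open>w j\<close>, then \<open>g * int p\<close> would be a
    common divisor of all \<open>u j\<close>, contradicting the choice of \<open>g\<close>.\<close>
  have "\<not> [:int p:] dvd f"
  proof
    assume "[:int p:] dvd f"
    hence "int p dvd w j" if "j \<in> I" for j using coeff[OF that] by (metis const_poly_dvd_iff)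
    hence "g * int p dvd u j" if "j \<in> I" for j using u[OF that] that by simp
    hence "g * int p dvd g" unfolding g_def by (intro Gcd_greatest) auto
    thus False using g0 assms(1) by (simp add: prime_nat_iff)
  qed
  hence "card {s. s < p \<and> int p dvd poly f (int s)} \<le> degree f"
    by (rule card_roots_mod_prime[OF assms(1)])
  moreover have "{s. s < p \<and> (\<Sum>i\<in>I. int (s ^ e i mod p) * u i) = v}
      \<subseteq> {s. s < p \<and> int p dvd poly f (int s)}"
  proof safe
    fix s assume s: "v = (\<Sum>i\<in>I. int (s ^ e i mod p) * u i)"
    have "g * (\<Sum>i\<in>I. int (s ^ e i mod p) * w i) = g * v'"
      by (simp add: v[symmetric] s sum_distrib_left u mult_ac cong: sum.cong)
    hence *: "(\<Sum>i\<in>I. int (s ^ e i mod p) * w i) = v'" using g0 by simp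
    \<comment> \<open>Replacing residues by the powers themselves changes the value by a multiple of
      p, so an exact solution becomes a root mod p.\<close>
    have "poly f (int s) = (\<Sum>i\<in>I. (int s ^ e i - int (s ^ e i mod p)) * w i)"
      unfolding f_def by (simp add: poly_sum poly_monom *[symmetric] sum_subtractf algebra_simps)
    also have "int p dvd \<dots>"
    proof (intro dvd_sum dvd_mult2)
      fix i
      show "int p dvd int s ^ e i - int (s ^ e i mod p)"
        by (simp add: zmod_int mod_eq_dvd_iff[symmetric])
    qed
    finally show "int p dvd poly f (int s)" .
  qed
  hence "card {s. s < p \<and> (\<Sum>i\<in>I. int (s ^ e i mod p) * u i) = v}
      \<le> card {s. s < p \<and> int p dvd poly f (int s)}" by (intro card_mono) simp_all
  ultimately show ?thesis using deg by linarith
qed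

section \<open>Padding a configuration\<close>

text \<open>Non-vertical hyperplanes. A line in direction \<open>k\<close> meets each of them in a
  single point, so all but finitely many points of the line avoid a given finite family; padding
  relies on this.\<close>

definition sloped :: "'n \<Rightarrow> (real ^ 'n::finite) set \<Rightarrow> bool" where
  "sloped k h \<longleftrightarrow> (\<exists>a c. a $ k \<noteq> 0 \<and> h = {x. a \<bullet> x = c})"

lemma sloped_imp_hyperplane: "sloped k h \<Longrightarrow> hyperplane h"
proof -
  assume "sloped k h"
  then obtain a c where a: "a $ k \<noteq> 0" and h: "h = {x. a \<bullet> x = c}" unfolding sloped_def by blast
  have "a \<noteq> 0" using a by auto
  thus ?thesis using h unfolding hyperplane_def by blast
qed

lemma finite_incidences:
  assumes "finite P" "finite H"
  shows "finite (incidences P H)"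
proof (rule finite_subset)
  show "incidences P H \<subseteq> P \<times> H" by (auto simp: incidences_def)
  show "finite (P \<times> H)" using assms by blast
qed

text \<open>The new points lie on a line in direction \<open>k\<close> inside the single new hyperplane \<open>x\<^sub>j = c\<close>, which
  misses the old points; the other new hyperplanes pass through one of the new points and no other point.\<close>
lemma pad_configuration:
  fixes P\<^sub>0 :: "(real ^ 'n::finite) set" and j k :: 'n
  assumes jk: "j \<noteq> k" and fin: "finite P\<^sub>0" "finite H\<^sub>0" and sl: "\<And>h. h \<in> H\<^sub>0 \<Longrightarrow> sloped k h"
    and K: "\<not> contains_K s (t + 1) P\<^sub>0 H\<^sub>0" and st: "2 \<le> s" "1 \<le> t"
    and size: "2 * card P\<^sub>0 \<le> m" "2 * card H\<^sub>0 \<le> n" "0 < m" "0 < n"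
  shows "\<exists>(P :: (real ^ 'n) set) H. finite P \<and> card P = m \<and> finite H \<and> card H = n \<and> (\<forall>h\<in>H. hyperplane h) \<and>
    \<not> contains_K s (t + 1) P H \<and> real (num_incidences P H) \<ge> real (num_incidences P\<^sub>0 H\<^sub>0) + (real m + real n) / 4"
proof -
  obtain c where c: "c \<notin> (\<lambda>x. x $ j) ` P\<^sub>0"
    using ex_new_if_finite[OF infinite_UNIV_char_0 finite_imageI[OF fin(1)]] by blast
  define L :: "real \<Rightarrow> real ^ 'n" where "L y = axis j c + axis k y" for y
  have L: "L y $ j = c" "L y $ k = y" for y using jk by (auto simp: L_def axis_def)
  have inner_L: "a \<bullet> L y = a $ j * c + a $ k * y" for a y
    by (simp add: L_def inner_add_right inner_axis)
  have "finite {y. L y \<in> h}" if h: "h \<in> H\<^sub>0" for h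
  proof -
    obtain a b where "a $ k \<noteq> 0" "h = {x. a \<bullet> x = b}" using sl[OF h] by (auto simp: sloped_def)
    hence "{y. L y \<in> h} \<subseteq> {(b - a $ j * c) / a $ k}" by (auto simp: inner_L field_simps)
    thus ?thesis by (rule finite_subset) simp
  qed
  hence "finite (\<Union>h\<in>H\<^sub>0. {y. L y \<in> h})" using fin by blast
  hence "infinite (UNIV - (\<Union>h\<in>H\<^sub>0. {y. L y \<in> h}))"
    by (intro Diff_infinite_finite infinite_UNIV_char_0)
  then obtain Y where Y: "finite Y" "card Y = m - card P\<^sub>0" "Y \<subseteq> UNIV - (\<Union>h\<in>H\<^sub>0. {y. L y \<in> h})"
    using infinite_arbitrarily_large by blast
  have "Y \<noteq> {}" using Y(2) size by auto
  then obtain y\<^sub>0 where y0: "y\<^sub>0 \<in> Y" by blast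
  define Q where "Q = L ` Y"
  define V where "V = {x :: real ^ 'n. x $ j = c}"
  \<comment> \<open>A pencil through \<open>L y\<^sub>0\<close> whose remaining member is
    \<open>V\<close>. A point off \<open>V\<close> lies on exactly one \<open>G r\<close>, so the
    old points exclude only finitely many \<open>r\<close>.\<close>
  define G where "G r = {x :: real ^ 'n. x $ k + r * x $ j = y\<^sub>0 + r * c}" for r
  have "finite {r. q \<in> G r}" if "q \<in> P\<^sub>0" for q
  proof -
    have "q $ j \<noteq> c" using c that by auto
    hence "{r. q \<in> G r} \<subseteq> {(y\<^sub>0 - q $ k) / (q $ j - c)}" by (auto simp: G_def field_simps)
    thus ?thesis by (rule finite_subset) simp
  qed
  hence "finite (\<Union>q\<in>P\<^sub>0. {r. q \<in> G r})" using fin by blast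
  hence "infinite (UNIV - (\<Union>q\<in>P\<^sub>0. {r. q \<in> G r}))"
    by (intro Diff_infinite_finite infinite_UNIV_char_0)
  \<comment> \<open>The \<open>- 1\<close> reserves a place for \<open>V\<close>.\<close>
  then obtain R where R: "finite R" "card R = n - card H\<^sub>0 - 1" "R \<subseteq> UNIV - (\<Union>q\<in>P\<^sub>0. {r. q \<in> G r})"
    using infinite_arbitrarily_large by blast
  have inj_L: "inj L" by (rule injI) (metis L(2))
  have inj_G: "inj G"
  proof (rule injI)
    fix r r' assume eq: "G r = G r'"
    define x :: "real ^ 'n" where "x = axis j (c + 1) + axis k (y\<^sub>0 - r)"
    have x: "x $ j = c + 1" "x $ k = y\<^sub>0 - r" using jk by (auto simp: x_def axis_def)
    have "x \<in> G r" by (simp add: G_def x algebra_simps)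
    hence "x \<in> G r'" using eq by simp
    thus "r = r'" by (simp add: G_def x algebra_simps)
  qed
  have L_in_G: "L y \<in> G r \<longleftrightarrow> y = y\<^sub>0" for y r by (auto simp: G_def L)
  have L_in_V: "L y \<in> V" for y by (simp add: V_def L)
  have Q_H0: "q \<notin> h" if "q \<in> Q" "h \<in> H\<^sub>0" for q h using Y(3) that by (auto simp: Q_def)
  have P0_V: "p \<notin> V" if "p \<in> P\<^sub>0" for p using c that by (auto simp: V_def)
  have P0_G: "p \<notin> G r" if "p \<in> P\<^sub>0" "r \<in> R" for p r using R(3) that by blast
  have p0: "L y\<^sub>0 \<in> Q" using y0 by (simp add: Q_def)
  have disj_P: "P\<^sub>0 \<inter> Q = {}" using P0_V L_in_V by (auto simp: Q_def)
  have V_H0: "V \<notin> H\<^sub>0" using Q_H0[OF p0] L_in_V by blast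
  have G_H0: "G r \<notin> H\<^sub>0" for r using Q_H0[OF p0] L_in_G by blast
  have V_G: "V \<noteq> G r" for r using L_in_V[of "y\<^sub>0 + 1"] L_in_G[of "y\<^sub>0 + 1" r] by auto
  define P where "P = P\<^sub>0 \<union> Q"
  define H where "H = H\<^sub>0 \<union> insert V (G ` R)"
  have fQ: "finite Q" and cQ: "card Q = m - card P\<^sub>0"
    using Y inj_L by (auto simp: Q_def card_image inj_on_subset)
  have finP: "finite P" and finH: "finite H" using fin fQ R by (auto simp: P_def H_def)
  have cG: "card (G ` R) = n - card H\<^sub>0 - 1" using R inj_G by (simp add: card_image inj_on_subset)
  have "card P = m" unfolding P_def using disj_P fin fQ cQ size by (simp add: card_Un_disjoint)
  moreover have "card H = n"
  proof -
    have "card (insert V (G ` R)) = n - card H\<^sub>0" using V_G R cG size by (simp add: card_insert_if image_iff)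
    moreover have "H\<^sub>0 \<inter> insert V (G ` R) = {}" using V_H0 G_H0 by blast
    ultimately show ?thesis unfolding H_def using fin R size by (subst card_Un_disjoint) auto
  qed
  moreover have "\<forall>h\<in>H. hyperplane h"
  proof -
    have "hyperplane V" unfolding hyperplane_def
      by (intro exI[of _ "axis j 1"] exI[of _ c]) (auto simp: V_def inner_axis' axis_eq_0_iff)
    moreover have "hyperplane (G r)" for r unfolding hyperplane_def
    proof (intro exI conjI)
      show "axis k 1 + axis j r \<noteq> (0 :: real ^ 'n)"
        using jk by (auto simp: vec_eq_iff axis_def intro!: exI[of _ k])
      show "G r = {x. (axis k 1 + axis j r) \<bullet> x = y\<^sub>0 + r * c}"
        by (simp add: G_def inner_add_left inner_axis')
    qed
    ultimately show ?thesis using sl sloped_imp_hyperplane by (auto simp: H_def)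
  qed
  moreover have "\<not> contains_K s (t + 1) P H"
  proof
    assume "contains_K s (t + 1) P H"
    then obtain S T where S: "S \<subseteq> P" "card S = s" "finite S" and T: "T \<subseteq> H" "card T = t + 1" "finite T"
      and ST: "S \<times> T \<subseteq> incidences P H" unfolding contains_K_def by blast
    have inc: "p \<in> h" if "p \<in> S" "h \<in> T" for p h using ST that by (auto simp: incidences_def)
    \<comment> \<open>\<open>L y\<^sub>0\<close> is the only point of \<open>P\<close> on
      \<open>G r\<close>, but at least two common points are required.\<close>
    have noG: "G r \<notin> T" if "r \<in> R" for r
    proof
      assume "G r \<in> T"
      hence "S \<subseteq> {L y\<^sub>0}" using inc S(1) P0_G that L_in_G by (fastforce simp: P_def Q_def)
      thus False using S(2) st card_mono[of "{L y\<^sub>0}" S] by simp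
    qed
    \<comment> \<open>Points of \<open>P\<close> on \<open>V\<close> are new and lie on no old
      hyperplane, which would leave \<open>V\<close> as the only member of \<open>T\<close>,
      although \<open>t + 1\<close> is at least 2.\<close>
    have "V \<notin> T"
    proof
      assume "V \<in> T"
      hence "S \<subseteq> Q" using inc S(1) P0_V by (auto simp: P_def)
      moreover obtain q where "q \<in> S" using S(2) st by fastforce
      ultimately have "T \<inter> H\<^sub>0 = {}" using inc Q_H0 by blast
      hence "T \<subseteq> {V}" using T(1) noG by (auto simp: H_def)
      thus False using T(2) st card_mono[of "{V}" T] by simp
    qed
    hence TH: "T \<subseteq> H\<^sub>0" using T(1) noG by (auto simp: H_def)
    moreover obtain h where "h \<in> T" using T(2) by fastforce
    ultimately have SP: "S \<subseteq> P\<^sub>0" using inc Q_H0 S(1) unfolding P_def by blast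
    have "S \<times> T \<subseteq> incidences P\<^sub>0 H\<^sub>0" using inc SP TH by (auto simp: incidences_def)
    thus False using K SP TH S T unfolding contains_K_def by blast
  qed
  moreover have "real (num_incidences P H) \<ge> real (num_incidences P\<^sub>0 H\<^sub>0) + (real m + real n) / 4"
  proof -
    let ?I = "incidences P\<^sub>0 H\<^sub>0" and ?J = "Q \<times> {V}" and ?K = "{L y\<^sub>0} \<times> G ` R"
    have fI: "finite ?I" using fin by (rule finite_incidences)
    have "card (?I \<union> (?J \<union> ?K)) = card ?I + (card ?J + card ?K)"
    proof (subst card_Un_disjoint)
      show "?I \<inter> (?J \<union> ?K) = {}" using V_H0 G_H0 by (auto simp: incidences_def)
      show "card ?I + card (?J \<union> ?K) = card ?I + (card ?J + card ?K)"
        using V_G fQ R by (subst card_Un_disjoint) auto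
    qed (use fI fQ R in auto)
    also have "\<dots> = num_incidences P\<^sub>0 H\<^sub>0 + ((m - card P\<^sub>0) + (n - card H\<^sub>0 - 1))"
      using cQ cG by (simp add: num_incidences_def card_cartesian_product)
    finally have "num_incidences P\<^sub>0 H\<^sub>0 + ((m - card P\<^sub>0) + (n - card H\<^sub>0 - 1)) = card (?I \<union> (?J \<union> ?K))" ..
    also have "\<dots> \<le> num_incidences P H" unfolding num_incidences_def
    proof (rule card_mono)
      show "finite (incidences P H)"
        using finP finH by (rule finite_incidences)
      show "?I \<union> (?J \<union> ?K) \<subseteq> incidences P H"
      proof (intro Un_least)
        show "?I \<subseteq> incidences P H" by (auto simp: incidences_def P_def H_def)
        have "Q \<subseteq> V" using L_in_V by (auto simp: Q_def)
        thus "?J \<subseteq> incidences P H" by (auto simp: incidences_def P_def H_def)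
        have "L y\<^sub>0 \<in> P" using p0 by (simp add: P_def)
        thus "?K \<subseteq> incidences P H" using L_in_G by (auto simp: incidences_def H_def)
      qed
    qed
    finally have "num_incidences P\<^sub>0 H\<^sub>0 + ((m - card P\<^sub>0) + (n - card H\<^sub>0 - 1)) \<le> num_incidences P H" .
    \<comment> \<open>At least m/2 points and n/2 hyperplanes are new. \<open>V\<close> is missing
      from the second summand; passing from 1/2 to 1/4 absorbs this, as the first summand is at
      least 1.\<close>
    moreover have "m + n \<le> 4 * ((m - card P\<^sub>0) + (n - card H\<^sub>0 - 1))" 
    proof -
      have le: "m + n \<le> 4 * (x + y)" if "m \<le> 2 * x" "n \<le> 2 * (y + 1)" "1 \<le> x" for x y
        using that by (simp add: distrib_left)
      show ?thesis by (rule le) (use size in simp_all)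
    qed
    moreover have "real a + (real m + real n) / 4 \<le> real b" if "a + w \<le> b" "m + n \<le> 4 * w" for a b w :: nat
    proof -
      have "real (a + w) \<le> real b" "real (m + n) \<le> real (4 * w)" using that by (simp_all only: of_nat_le_iff)
      thus ?thesis by (simp add: field_simps)
    qed
    ultimately show ?thesis by blast
  qed
  ultimately show ?thesis using finP finH by blast
qed

section \<open>From block configurations to all parameters\<close>

definition sloped_config :: "'n::finite \<Rightarrow> nat \<Rightarrow> nat \<Rightarrow> (real ^ 'n) set \<Rightarrow> (real ^ 'n) set set \<Rightarrow> bool" where
  "sloped_config k s t P H \<longleftrightarrow>
     finite P \<and> finite H \<and> (\<forall>h\<in>H. sloped k h) \<and> \<not> contains_K s (t + 1) P H"

lemma floor_ge_half:
  fixes x :: real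
  assumes "1 \<le> x"
  obtains N :: nat where "1 \<le> N" "real N \<le> x" "x / 2 \<le> real N"
proof
  show "1 \<le> nat \<lfloor>x\<rfloor>" using assms by (simp add: le_nat_iff le_floor_iff)
  show "real (nat \<lfloor>x\<rfloor>) \<le> x" using assms by simp
  have "1 \<le> \<lfloor>x\<rfloor>" using assms by (simp add: le_floor_iff)
  hence "1 \<le> real (nat \<lfloor>x\<rfloor>)" by simp
  moreover have "x < real (nat \<lfloor>x\<rfloor>) + 1" using assms by simp
  ultimately show "x / 2 \<le> real (nat \<lfloor>x\<rfloor>)" by (simp add: field_simps)
qed

text \<open>\<open>N\<close> and \<open>M\<close> solve \<open>N M\<^sup>e = m\<close> and \<open>N\<^sup>\<kappa> M = n\<close>.\<close>
lemma main_term_cases: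
  fixes m n \<kappa> e \<gamma> :: real
  assumes mn: "1 \<le> m" "1 \<le> n" and e: "1 < e" and k: "1 < \<kappa>" and g: "0 < \<gamma>" 
  defines "E \<equiv> \<kappa> * e - 1"
  defines "N \<equiv> n powr (e / E) * m powr (- 1 / E)" and "M \<equiv> m powr (\<kappa> / E) * n powr (- 1 / E)"
    and "Z \<equiv> m powr (\<kappa> * (e - 1) / E) * n powr (e * (\<kappa> - 1) / E)"
  shows "N * M powr e = m" "N powr \<kappa> * M = n" "N powr \<kappa> * M powr e = Z"
    "\<gamma> * N \<le> 1 \<Longrightarrow> Z \<le> (1 / \<gamma>) powr (\<kappa> - 1) * m"
    "\<gamma> * M \<le> 1 \<Longrightarrow> Z \<le> (1 / \<gamma>) powr (e - 1) * n"
    "0 < N" "0 < M" "0 < E"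
proof -
  have "1 * 1 < \<kappa> * e" using e k by (intro mult_strict_mono) auto
  thus E: "0 < E" by (simp add: E_def)
  show N0: "0 < N" "0 < M" using mn by (auto simp: N_def M_def)
  have Np: "N powr x = n powr (e * x / E) * m powr (- x / E)" for x
    using mn by (simp add: N_def powr_mult powr_powr)
  have Mp: "M powr x = m powr (\<kappa> * x / E) * n powr (- x / E)" for x
    using mn by (simp add: M_def powr_mult powr_powr)
  have eq: "(n powr a * m powr b) * (m powr c * n powr d) = m powr (b + c) * n powr (a + d)" for a b c d
    by (simp add: powr_add)
  have 1: "(\<kappa> * e - 1) / E = 1" using E by (simp add: E_def)
  have "N * M powr e = m powr (- 1 / E + \<kappa> * e / E) * n powr (e / E + (- e / E))"
    unfolding Mp by (simp only: N_def eq)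
  also have "- 1 / E + \<kappa> * e / E = 1" using 1 by (simp add: diff_divide_distrib)
  finally show "N * M powr e = m" using mn by simp
  have "N powr \<kappa> * M = m powr (- \<kappa> / E + \<kappa> / E) * n powr (e * \<kappa> / E + (- 1 / E))"
    unfolding Np by (simp only: M_def eq)
  also have "e * \<kappa> / E + (- 1 / E) = 1" using 1 by (simp add: diff_divide_distrib mult.commute)
  finally show "N powr \<kappa> * M = n" using mn by simp
  have "N powr \<kappa> * M powr e = m powr (- \<kappa> / E + \<kappa> * e / E) * n powr (e * \<kappa> / E + (- e / E))"
    unfolding Np Mp by (simp only: eq)
  also have "- \<kappa> / E + \<kappa> * e / E = \<kappa> * (e - 1) / E" by (simp add: diff_divide_distrib right_diff_distrib)
  also have "e * \<kappa> / E + (- e / E) = e * (\<kappa> - 1) / E" by (simp add: diff_divide_distrib right_diff_distrib)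
  finally show "N powr \<kappa> * M powr e = Z" by (simp add: Z_def)
  \<comment> \<open>Here Z = N^\<kappa> M^e = N^(\<kappa>-1) (N M^e) = N^(\<kappa>-1) m, and N is at
    most 1/\<gamma>.\<close>
  show "Z \<le> (1 / \<gamma>) powr (\<kappa> - 1) * m" if "\<gamma> * N \<le> 1"
  proof -
    have "N powr (\<kappa> - 1) \<le> (1 / \<gamma>) powr (\<kappa> - 1)"
      using that g N0 k by (intro powr_mono2) (auto simp: field_simps)
    hence "N powr (\<kappa> - 1) * m \<le> (1 / \<gamma>) powr (\<kappa> - 1) * m" using mn by (intro mult_right_mono) auto
    also have "N powr (\<kappa> - 1) * m = (n powr (e * (\<kappa> - 1) / E) * m powr (- (\<kappa> - 1) / E)) * (m powr 1 * n powr 0)"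
      unfolding Np using mn by simp
    also have "\<dots> = m powr (- (\<kappa> - 1) / E + 1) * n powr (e * (\<kappa> - 1) / E)" unfolding eq by simp
    also have "- (\<kappa> - 1) / E + 1 = \<kappa> * (e - 1) / E" using E by (simp add: field_simps) (simp add: E_def algebra_simps)
    finally show ?thesis by (simp add: Z_def)
  qed
  \<comment> \<open>Symmetrically, Z = M^(e-1) (N^\<kappa> M) = M^(e-1) n.\<close>
  show "Z \<le> (1 / \<gamma>) powr (e - 1) * n" if "\<gamma> * M \<le> 1"
  proof -
    have "M powr (e - 1) \<le> (1 / \<gamma>) powr (e - 1)"
      using that g N0 e by (intro powr_mono2) (auto simp: field_simps)
    hence "M powr (e - 1) * n \<le> (1 / \<gamma>) powr (e - 1) * n" using mn by (intro mult_right_mono) auto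
    also have "M powr (e - 1) * n = (n powr 1 * m powr 0) * (m powr (\<kappa> * (e - 1) / E) * n powr (- (e - 1) / E))"
      unfolding Mp using mn by simp
    also have "\<dots> = m powr (\<kappa> * (e - 1) / E) * n powr (1 + (- (e - 1) / E))" unfolding eq by simp
    also have "1 + (- (e - 1) / E) = e * (\<kappa> - 1) / E" using E by (simp add: field_simps) (simp add: E_def algebra_simps)
    finally show ?thesis by (simp add: Z_def)
  qed
qed

text \<open>The ideal real parameters are shrunk by a constant and rounded down, and the resulting
  block is padded. Blocks are demanded for every loss \<delta>, because \<delta> is chosen from
  \<epsilon>, while \<open>s\<close>, \<open>t\<close> and \<open>C\<close> stay the same.\<close>

lemma incidences_from_blocks:
  fixes e \<kappa> C \<epsilon> :: real and j k :: "'n::finite"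
  assumes jk: "j \<noteq> k" and e: "1 < e" and \<kappa>: "1 < \<kappa>" and st: "2 \<le> s" "1 \<le> t" and C: "0 < C" and \<epsilon>: "0 < \<epsilon>"
    and blocks: "\<And>\<delta>. 0 < \<delta> \<Longrightarrow> \<exists>c>0. \<forall>N M. 1 \<le> N \<longrightarrow> 1 \<le> M \<longrightarrow>
      (\<exists>P H. sloped_config k s t P H \<and>
        real (card P) \<le> C * (real N * real M powr e) \<and> real (card H) \<le> C * (real N powr \<kappa> * real M) \<and>
        c * (real N powr (\<kappa> - \<delta>) * real M powr e) \<le> real (num_incidences P H))"
  shows "\<exists>b>0. \<forall>n m. 0 < n \<longrightarrow> 0 < m \<longrightarrow>
    (\<exists>(P :: (real ^ 'n) set) H. finite P \<and> card P = m \<and> finite H \<and> card H = n \<and> (\<forall>h\<in>H. hyperplane h) \<and>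
      \<not> contains_K s (t + 1) P H \<and>
      real (num_incidences P H) \<ge> b * (real m powr (\<kappa> * (e - 1) / (\<kappa> * e - 1)) *
        real n powr (e * (\<kappa> - 1) / (\<kappa> * e - 1) - \<epsilon>) + real m + real n))"
proof -
  define E where "E = \<kappa> * e - 1"
  define \<alpha> where "\<alpha> = \<kappa> * (e - 1) / E"
  define \<beta> where "\<beta> = e * (\<kappa> - 1) / E"
  have E: "0 < E" using main_term_cases(8)[of 1 1 e \<kappa> 1] e \<kappa> by (simp add: E_def)
  \<comment> \<open>Since N = n^(e/E) m^(-1/E) and m >= 1, the factor N^(-\<delta>) is at least
    n^(-\<delta> e/E); the first bound makes this at least n^(-\<epsilon>). The bound by \<kappa>
    keeps the exponent \<kappa> - \<delta> nonnegative, so that the power is monotone in N.\<close>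
  define \<delta> where "\<delta> = min (\<epsilon> * E / e) \<kappa>"
  have \<delta>: "0 < \<delta>" "\<delta> \<le> \<kappa>" "\<delta> * e / E \<le> \<epsilon>" using \<epsilon> E e \<kappa> by (auto simp: \<delta>_def min_def field_simps)
  obtain c where c: "0 < c" and block: "\<And>N M. 1 \<le> N \<Longrightarrow> 1 \<le> M \<Longrightarrow>
      \<exists>P H. sloped_config k s t P H \<and>
        real (card P) \<le> C * (real N * real M powr e) \<and> real (card H) \<le> C * (real N powr \<kappa> * real M) \<and>
        c * (real N powr (\<kappa> - \<delta>) * real M powr e) \<le> real (num_incidences P H)"
    using blocks[OF \<delta>(1)] by blast
  \<comment> \<open>One factor \<gamma> brings the block sizes C N M^e and C N^\<kappa> M down to at
    most m/2 and n/2.\<close>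
  define \<gamma> where "\<gamma> = min 1 (1 / (2 * C))"
  have \<gamma>: "0 < \<gamma>" "\<gamma> \<le> 1" "2 * C * \<gamma> \<le> 1" using C by (auto simp: \<gamma>_def min_def field_simps)
  define K where "K = (1 / \<gamma>) powr (\<kappa> - 1) + (1 / \<gamma>) powr (e - 1)"
  have K: "0 \<le> K" by (simp add: K_def)
  \<comment> \<open>The first entry pays for shrinking and rounding, which keep at least the
    fraction \<gamma>/2 of each parameter. The second serves the degenerate case, where the target
    is at most b (K+1) (m+n) and padding offers (m+n)/4.\<close>
  define b where "b = min (c * ((\<gamma> / 2) powr (\<kappa> - \<delta>) * (\<gamma> / 2) powr e)) (1 / (4 * (K + 1)))"
  have b: "0 < b" "b \<le> c * ((\<gamma> / 2) powr (\<kappa> - \<delta>) * (\<gamma> / 2) powr e)" "b * (K + 1) \<le> 1 / 4" "b \<le> 1 / 4"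
  proof -
    show "0 < b" "b \<le> c * ((\<gamma> / 2) powr (\<kappa> - \<delta>) * (\<gamma> / 2) powr e)" using c \<gamma> K by (auto simp: b_def)
    have "b \<le> 1 / (4 * (K + 1))" by (simp add: b_def)
    thus 1: "b * (K + 1) \<le> 1 / 4" using K by (simp add: field_simps)
    have "b * 1 \<le> b * (K + 1)" using \<open>0 < b\<close> K by (intro mult_left_mono) auto
    thus "b \<le> 1 / 4" using 1 by linarith
  qed
  have "\<exists>(P :: (real ^ 'n) set) H. finite P \<and> card P = m \<and> finite H \<and> card H = n \<and> (\<forall>h\<in>H. hyperplane h) \<and>
      \<not> contains_K s (t + 1) P H \<and>
      real (num_incidences P H) \<ge> b * (real m powr \<alpha> * real n powr (\<beta> - \<epsilon>) + real m + real n)"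
    if n0: "0 < n" and m0: "0 < m" for n m
  proof -
    define N0 where "N0 = real n powr (e / E) * real m powr (- 1 / E)"
    define M0 where "M0 = real m powr (\<kappa> / E) * real n powr (- 1 / E)"
    define Z where "Z = real m powr \<alpha> * real n powr \<beta>"
    have m1: "1 \<le> real m" and n1: "1 \<le> real n" using m0 n0 by simp_all
    note main = main_term_cases[OF m1 n1 e \<kappa> \<gamma>(1), folded E_def, folded N0_def M0_def, folded \<alpha>_def \<beta>_def, folded Z_def]
    have Z: "real m powr \<alpha> * real n powr (\<beta> - \<epsilon>) \<le> Z"
      unfolding Z_def using n1 \<epsilon> by (intro mult_left_mono powr_mono) auto
    have "\<exists>P H. sloped_config k s t P H \<and> 2 * card P \<le> m \<and> 2 * card H \<le> n \<and>
        b * (real m powr \<alpha> * real n powr (\<beta> - \<epsilon>) + real m + real n)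
          \<le> real (num_incidences P H) + (real m + real n) / 4"
    proof (cases "1 \<le> \<gamma> * N0 \<and> 1 \<le> \<gamma> * M0")
      \<comment> \<open>No block fits, so the empty configuration is padded.\<close>
      case False
      hence "Z \<le> K * (real m + real n)"
      proof -
        have "Z \<le> (1 / \<gamma>) powr (\<kappa> - 1) * real m \<or> Z \<le> (1 / \<gamma>) powr (e - 1) * real n"
          using False main(4,5) by linarith
        moreover have "(1 / \<gamma>) powr (\<kappa> - 1) * real m \<le> K * (real m + real n)"
          "(1 / \<gamma>) powr (e - 1) * real n \<le> K * (real m + real n)"
          by (auto simp: K_def intro!: mult_mono)
        ultimately show ?thesis by linarith
      qed
      hence "real m powr \<alpha> * real n powr (\<beta> - \<epsilon>) + real m + real n \<le> (K + 1) * (real m + real n)"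
        using Z by (simp add: algebra_simps)
      hence "b * (real m powr \<alpha> * real n powr (\<beta> - \<epsilon>) + real m + real n) \<le> b * ((K + 1) * (real m + real n))"
        using b by (intro mult_left_mono) auto
      also have "\<dots> \<le> 1 / 4 * (real m + real n)"
        unfolding mult.assoc[symmetric] using b by (intro mult_right_mono) auto
      also have "\<dots> \<le> real (num_incidences {} ({} :: (real ^ 'n) set set)) + (real m + real n) / 4" by simp
      finally have "b * (real m powr \<alpha> * real n powr (\<beta> - \<epsilon>) + real m + real n)
          \<le> real (num_incidences {} ({} :: (real ^ 'n) set set)) + (real m + real n) / 4" .
      moreover have "sloped_config k s t {} {}" using st by (auto simp: sloped_config_def contains_K_def)
      ultimately show ?thesis by - (rule exI[of _ "{}"], rule exI[of _ "{}"], simp)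
    next
      case True
      obtain N where N: "1 \<le> N" "real N \<le> \<gamma> * N0" "\<gamma> * N0 / 2 \<le> real N"
        using floor_ge_half[of "\<gamma> * N0"] True by metis
      obtain M where M: "1 \<le> M" "real M \<le> \<gamma> * M0" "\<gamma> * M0 / 2 \<le> real M"
        using floor_ge_half[of "\<gamma> * M0"] True by metis
      obtain P H where PH: "sloped_config k s t P H"
        "real (card P) \<le> C * (real N * real M powr e)" "real (card H) \<le> C * (real N powr \<kappa> * real M)"
        "c * (real N powr (\<kappa> - \<delta>) * real M powr e) \<le> real (num_incidences P H)"
        using block[OF N(1) M(1)] by blast
      have MM0: "real M \<le> M0" using M(2) \<gamma>(2) main(7) mult_right_mono[of \<gamma> 1 M0] by linarith
      have NN0: "real N \<le> N0" using N(2) \<gamma>(2) main(6) mult_right_mono[of \<gamma> 1 N0] by linarith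
      have "real (card P) \<le> C * ((\<gamma> * N0) * M0 powr e)"
        using PH(2) N(2) MM0 C e \<gamma> main(6) 
        by (elim order_trans, intro mult_left_mono mult_mono powr_mono2) auto
      also have "\<dots> = C * \<gamma> * real m" using main(1) by (simp add: mult_ac)
      finally have "2 * real (card P) \<le> 2 * C * \<gamma> * real m" by simp
      also have "\<dots> \<le> 1 * real m" using \<gamma> by (intro mult_right_mono) auto
      finally have cP: "2 * card P \<le> m" by linarith
      have "real (card H) \<le> C * (N0 powr \<kappa> * (\<gamma> * M0))"
        using PH(3) M(2) NN0 C \<kappa> \<gamma> main(6) 
        by (elim order_trans, intro mult_left_mono mult_mono powr_mono2) auto
      also have "\<dots> = C * \<gamma> * real n" using main(2) by (simp add: mult_ac)
      finally have "2 * real (card H) \<le> 2 * C * \<gamma> * real n" by simp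
      also have "\<dots> \<le> 1 * real n" using \<gamma> by (intro mult_right_mono) auto
      finally have cH: "2 * card H \<le> n" by linarith
      have "real n powr (- \<epsilon>) * 1 \<le> real n powr (- (\<delta> * e / E)) * real m powr (\<delta> / E)"
        using \<delta> E n1 m1 by (intro mult_mono powr_mono ge_one_powr_ge_zero) auto
      also have "\<dots> = N0 powr (- \<delta>)" using n1 m1 by (simp add: N0_def powr_mult powr_powr mult_ac)
      finally have "Z * real n powr (- \<epsilon>) \<le> N0 powr \<kappa> * M0 powr e * N0 powr (- \<delta>)"
        unfolding main(3) by (intro mult_left_mono) (auto simp: Z_def)
      hence le: "real m powr \<alpha> * real n powr (\<beta> - \<epsilon>) \<le> N0 powr (\<kappa> - \<delta>) * M0 powr e"
        by (simp add: Z_def powr_diff powr_minus field_simps)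
      have "b * (real m powr \<alpha> * real n powr (\<beta> - \<epsilon>))
          \<le> c * ((\<gamma> / 2) powr (\<kappa> - \<delta>) * (\<gamma> / 2) powr e) * (N0 powr (\<kappa> - \<delta>) * M0 powr e)"
        using b c by (intro mult_mono[OF _ le]) auto
      also have "\<dots> = c * ((\<gamma> * N0 / 2) powr (\<kappa> - \<delta>) * (\<gamma> * M0 / 2) powr e)"
        using \<gamma> main(6,7) powr_mult[of "\<gamma> / 2" N0] powr_mult[of "\<gamma> / 2" M0] by simp
      also have "\<dots> \<le> c * (real N powr (\<kappa> - \<delta>) * real M powr e)"
        using c N M \<gamma> main(6,7) \<delta> e by (intro mult_left_mono mult_mono powr_mono2) auto
      also note PH(4)
      finally have "b * (real m powr \<alpha> * real n powr (\<beta> - \<epsilon>)) \<le> real (num_incidences P H)" .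
      moreover have "b * (real m + real n) \<le> 1 / 4 * (real m + real n)"
        using b by (intro mult_right_mono) auto
      ultimately have "b * (real m powr \<alpha> * real n powr (\<beta> - \<epsilon>) + real m + real n)
          \<le> real (num_incidences P H) + (real m + real n) / 4"
        by (simp add: distrib_left add.assoc add_divide_distrib)
      thus ?thesis using PH(1) cP cH by blast
    qed
    then obtain P\<^sub>0 H\<^sub>0 where PH: "sloped_config k s t P\<^sub>0 H\<^sub>0" "2 * card P\<^sub>0 \<le> m" "2 * card H\<^sub>0 \<le> n"
      and *: "b * (real m powr \<alpha> * real n powr (\<beta> - \<epsilon>) + real m + real n)
          \<le> real (num_incidences P\<^sub>0 H\<^sub>0) + (real m + real n) / 4" by blast
    have "\<exists>(P :: (real ^ 'n) set) H. finite P \<and> card P = m \<and> finite H \<and> card H = n \<and> (\<forall>h\<in>H. hyperplane h) \<and>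
        \<not> contains_K s (t + 1) P H \<and>
        real (num_incidences P H) \<ge> real (num_incidences P\<^sub>0 H\<^sub>0) + (real m + real n) / 4"
      using PH st m0 n0 jk unfolding sloped_config_def by (intro pad_configuration[where j = j and k = k]) auto
    thus ?thesis using * order_trans by blast
  qed
  thus ?thesis using b(1) unfolding \<alpha>_def \<beta>_def E_def by blast
qed

section \<open>Configurations over a lattice grid\<close>

text \<open>Coordinate \<open>k\<close> is set aside: it is 0 for base points x and -1 for normals
  a, so that <a, z> = -b reads z_k = <a, x> + b.\<close>

definition nat_vec :: "'n::finite \<Rightarrow> real \<Rightarrow> ('n \<Rightarrow> nat) \<Rightarrow> real ^ 'n" where
  "nat_vec k c f = (\<chi> i. if i = k then c else real (f i))"

definition grid :: "'n::finite \<Rightarrow> real \<Rightarrow> nat \<Rightarrow> (real ^ 'n) set" where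
  "grid k c N = nat_vec k c ` ((UNIV - {k}) \<rightarrow>\<^sub>E {..<N})"

lemma nat_vec_nth [simp]: "nat_vec k c f $ i = (if i = k then c else real (f i))"
  by (simp add: nat_vec_def)

lemma inj_on_nat_vec: "inj_on (nat_vec k c) ((UNIV - {k}) \<rightarrow>\<^sub>E A)"
proof (rule inj_onI)
  fix f g assume fg: "f \<in> (UNIV - {k}) \<rightarrow>\<^sub>E A" "g \<in> (UNIV - {k}) \<rightarrow>\<^sub>E A" and eq: "nat_vec k c f = nat_vec k c g"
  show "f = g"
  proof (rule PiE_ext[OF fg])
    fix i assume "i \<in> UNIV - {k}"
    thus "f i = g i" using arg_cong[OF eq, of "\<lambda>x. x $ i"] by simp
  qed
qed

lemma finite_grid [simp]: "finite (grid k c N)"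
  unfolding grid_def by (intro finite_imageI finite_PiE) auto

lemma card_grid: "card (grid (k :: 'n::finite) c N) = N ^ (CARD('n) - 1)"
  unfolding grid_def by (subst card_image[OF inj_on_nat_vec]) (simp add: card_PiE card_Diff_singleton)

lemma grid_nth_self: "x \<in> grid k c N \<Longrightarrow> x $ k = c"
  unfolding grid_def by (elim imageE) simp

lemma gridE:
  assumes "x \<in> grid k c N"
  obtains f where "x = nat_vec k c f" "\<And>i. i \<noteq> k \<Longrightarrow> f i < N"
proof -
  from assms obtain f where f: "x = nat_vec k c f" "f \<in> (UNIV - {k}) \<rightarrow>\<^sub>E {..<N}"
    unfolding grid_def by (rule imageE)
  have "f i < N" if "i \<noteq> k" for i
    using PiE_mem[OF f(2), of i] that by simp
  thus ?thesis using that[of f] f(1) by blast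
qed

lemma nat_vec_in_grid:
  assumes "\<And>i. i \<noteq> k \<Longrightarrow> f i < N"
  shows "nat_vec k c f \<in> grid k c N"
  unfolding grid_def
proof (rule image_eqI)
  show "nat_vec k c f = nat_vec k c (restrict f (UNIV - {k}))" by (simp add: vec_eq_iff)
  show "restrict f (UNIV - {k}) \<in> (UNIV - {k}) \<rightarrow>\<^sub>E {..<N}" using assms by (intro restrict_PiE_iff[THEN iffD2]) auto
qed

lemma inner_nat_vec:
  "nat_vec k 0 g \<bullet> nat_vec k c f = real (\<Sum>i\<in>UNIV - {k}. g i * f i)"
proof -
  have "nat_vec k 0 g \<bullet> nat_vec k c f = (\<Sum>i\<in>UNIV. if i = k then 0 else real (g i) * real (f i))"
    unfolding inner_vec_def by (intro sum.cong) auto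
  also have "\<dots> = (\<Sum>i\<in>UNIV - {k}. real (g i) * real (f i))"
    by (simp add: sum.If_cases Compl_eq_Diff_UNIV)
  finally show ?thesis by simp
qed

text \<open>Serves two purposes: it bounds the heights <a, x> and, with both arguments equal, the
  number of spheres meeting the grid.\<close>

lemma inner_grid_bound:
  assumes "a \<in> grid (k :: 'n::finite) c N" "x \<in> grid k 0 M"
  obtains y :: nat where "a \<bullet> x = real y" "y \<le> (CARD('n) - 1) * (N * M)"
proof -
  obtain f where f: "a = nat_vec k c f" "\<And>i. i \<noteq> k \<Longrightarrow> f i < N" using assms(1) by (rule gridE) blast
  obtain g where g: "x = nat_vec k 0 g" "\<And>i. i \<noteq> k \<Longrightarrow> g i < M" using assms(2) by (rule gridE) blast
  have "a \<bullet> x = real (\<Sum>i\<in>UNIV - {k}. g i * f i)"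
    unfolding f(1) g(1) by (subst inner_commute) (rule inner_nat_vec)
  moreover have "(\<Sum>i\<in>UNIV - {k}. g i * f i) \<le> (\<Sum>i\<in>UNIV - {k}. N * M)"
  proof (rule sum_mono)
    fix i assume "i \<in> UNIV - {k}"
    hence "f i \<le> N" "g i \<le> M" using f(2)[of i] g(2)[of i] by auto
    thus "g i * f i \<le> N * M" by (subst mult.commute) (rule mult_mono, auto)
  qed
  hence "(\<Sum>i\<in>UNIV - {k}. g i * f i) \<le> (CARD('n) - 1) * (N * M)" by (simp add: card_Diff_singleton)
  ultimately show ?thesis by (rule that)
qed

text \<open>For \<open>a\<^sub>k = -1\<close> this is the graph of \<open>x\<^sub>k\<close> as the affine function with slope \<open>a\<close> and offset
  \<open>b\<close> of the other coordinates.\<close>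
definition level :: "real ^ 'n::finite \<Rightarrow> nat \<Rightarrow> (real ^ 'n) set" where
  "level a b = {z. a \<bullet> z = - real b}"

lemma inner_add_axis: "a \<bullet> (x + axis k y) = a \<bullet> x + a $ k * (y :: real)"
  by (simp add: inner_add_right inner_axis)

text \<open>Fixing \<open>a $ k = -1\<close> removes the freedom to scale a normal vector;
  \<open>b\<close> and the entries of \<open>a\<close> are then read off as heights of the graph at
  the origin and at the unit vectors.\<close>

lemma level_inj:
  assumes eq: "level a b = level a' b'" and k: "a $ k = -1" "a' $ k = -1"
  shows "a = a'" "b = b'"
proof -
  have "axis k (real b) \<in> level a b" using k by (simp add: level_def inner_axis)
  hence "axis k (real b) \<in> level a' b'" by (simp add: eq)
  thus b: "b = b'" using k by (simp add: level_def inner_axis)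
  show "a = a'"
  proof (rule vec_eq_iff[THEN iffD2], rule allI)
    fix i
    have "axis i 1 + axis k (a $ i + real b) \<in> level a b"
      using k by (simp add: level_def inner_add_axis inner_axis)
    hence "axis i 1 + axis k (a $ i + real b) \<in> level a' b'" by (simp add: eq)
    thus "a $ i = a' $ i" using k b by (simp add: level_def inner_add_axis inner_axis)
  qed
qed

text \<open>\<open>deg\<close> bounds the slopes for which some offset fits prescribed heights over
  \<open>s\<close> base points. This excludes the complete bipartite graph, because points on a
  common non-vertical hyperplane have distinct base points and hyperplanes through a common point
  have distinct slopes.\<close>

lemma lifted_grid_config:
  fixes k :: "'n::finite" and S X :: "(real ^ 'n) set"
  assumes S: "S \<subseteq> grid k (-1) N" and X: "X \<subseteq> grid k 0 M" and s: "1 \<le> s" and NM: "1 \<le> N" "1 \<le> M"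
    and deg: "\<And>Y v. Y \<subseteq> X \<Longrightarrow> card Y = s \<Longrightarrow> card {a \<in> S. \<exists>b. \<forall>x\<in>Y. a \<bullet> x + b = v x} \<le> t"
  shows "\<exists>P H. sloped_config k s t P H \<and> card P \<le> card X * (CARD('n) * (N * M)) \<and>
    card H \<le> card S * (N * M) \<and> card S * (N * M) * card X \<le> num_incidences P H"
proof -
  have fS: "finite S" and fX: "finite X" using S X finite_subset finite_grid by blast+
  have Sk: "a $ k = -1" if "a \<in> S" for a using S that grid_nth_self by blast
  have Xk: "x $ k = 0" if "x \<in> X" for x using X that grid_nth_self by blast
  define P where "P = (\<lambda>(x, y). x + axis k (real y)) ` (X \<times> {..<CARD('n) * (N * M)})"
  define H where "H = (\<lambda>(a, b). level a b) ` (S \<times> {..<N * M})"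
  have finP: "finite P" and finH: "finite H" unfolding P_def H_def using fS fX by auto
  have cP: "card P \<le> card X * (CARD('n) * (N * M))"
    unfolding P_def using fX card_image_le[of "X \<times> {..<CARD('n) * (N * M)}"]
    by (simp add: card_cartesian_product)
  have cH: "card H \<le> card S * (N * M)"
    unfolding H_def using fS card_image_le[of "S \<times> {..<N * M}"] by (simp add: card_cartesian_product)
  have sl: "sloped k h" if h: "h \<in> H" for h
  proof -
    obtain a b where ab: "a \<in> S" "h = level a b" using h by (auto simp: H_def)
    hence "a $ k \<noteq> 0" using Sk by simp
    thus ?thesis unfolding sloped_def ab(2) level_def by blast
  qed
  have inc: "x + axis k y \<in> level a b \<longleftrightarrow> a \<bullet> x + real b = y" if "a \<in> S" for a b x y
    using Sk[OF that] by (auto simp: level_def inner_add_axis)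
  have "\<not> contains_K s (t + 1) P H"
  proof
    assume "contains_K s (t + 1) P H"
    then obtain A T where A: "A \<subseteq> P" "card A = s" "finite A" and T: "T \<subseteq> H" "card T = t + 1" "finite T"
      and AT: "A \<times> T \<subseteq> incidences P H" unfolding contains_K_def by blast
    have in_h: "p \<in> h" if "p \<in> A" "h \<in> T" for p h using AT that by (auto simp: incidences_def)
    define \<pi> where "\<pi> z = z - axis k (z $ k)" for z :: "real ^ 'n"
    have \<pi>: "z = \<pi> z + axis k (z $ k)" for z by (simp add: \<pi>_def)
    have \<pi>X: "\<pi> z \<in> X" if "z \<in> A" for z
    proof -
      obtain x y where "x \<in> X" "z = x + axis k y" using A(1) \<open>z \<in> A\<close> by (auto simp: P_def)
      moreover from this have "\<pi> z = x" using Xk by (simp add: \<pi>_def vec_eq_iff axis_def)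
      ultimately show ?thesis by simp
    qed
    obtain h\<^sub>0 where "h\<^sub>0 \<in> T" using T(2) by fastforce
    then obtain a\<^sub>0 b\<^sub>0 where h0: "level a\<^sub>0 b\<^sub>0 \<in> T" "a\<^sub>0 \<in> S" using T(1) by (auto simp: H_def)
    have on_h: "a \<bullet> \<pi> z + real b = z $ k" if "z \<in> A" "level a b \<in> T" "a \<in> S" for z a b
      using in_h[OF that(1,2)] inc[OF that(3), of "\<pi> z" "z $ k" b] by (simp flip: \<pi>)
    have inj: "inj_on \<pi> A"
    proof (rule inj_onI)
      fix z z' assume z: "z \<in> A" "z' \<in> A" "\<pi> z = \<pi> z'"
      hence "z $ k = z' $ k" using on_h[OF z(1) h0] on_h[OF z(2) h0] by simp
      thus "z = z'" using z(3) \<pi> by metis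
    qed
    \<comment> \<open>Injectivity of the projection makes the height a function of the base
      point.\<close>
    define v where "v x = inv_into A \<pi> x $ k" for x
    have v: "v (\<pi> z) = z $ k" if "z \<in> A" for z using that inj by (simp add: v_def)
    define B where "B = {a \<in> S. \<exists>b. \<forall>x\<in>\<pi> ` A. a \<bullet> x + b = v x}"
    have "card B \<le> t" unfolding B_def
      using A(2) inj \<pi>X by (intro deg) (auto simp: card_image)
    moreover have "card T \<le> card B"
    proof -
      obtain z\<^sub>0 where z0: "z\<^sub>0 \<in> A" using A(2) s by fastforce
      have "T \<subseteq> (\<lambda>a. {z. a \<bullet> z = - (z\<^sub>0 $ k - a \<bullet> \<pi> z\<^sub>0)}) ` B"
      proof
        fix h assume h: "h \<in> T"
        then obtain a b where ab: "a \<in> S" "h = level a b" using T(1) by (auto simp: H_def)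
        have "a \<in> B" unfolding B_def using ab on_h h v by auto
        moreover have "h = {z. a \<bullet> z = - (z\<^sub>0 $ k - a \<bullet> \<pi> z\<^sub>0)}"
          using on_h[OF z0, of a b] h ab by (auto simp: level_def)
        ultimately show "h \<in> (\<lambda>a. {z. a \<bullet> z = - (z\<^sub>0 $ k - a \<bullet> \<pi> z\<^sub>0)}) ` B" by blast
      qed
      thus ?thesis using fS by (intro surj_card_le) (auto simp: B_def)
    qed
    ultimately show False using T(2) by simp
  qed
  moreover have "card S * (N * M) * card X \<le> num_incidences P H"
  proof -
    define \<Phi> where "\<Phi> = (\<lambda>((a, b), x). (x + axis k (a \<bullet> x + real b), level a b))"
    have inj: "inj_on \<Phi> ((S \<times> {..<N * M}) \<times> X)"
    proof (rule inj_onI)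
      fix p q assume pq: "p \<in> (S \<times> {..<N * M}) \<times> X" "q \<in> (S \<times> {..<N * M}) \<times> X" "\<Phi> p = \<Phi> q"
      obtain a b x where p_eq: "p = ((a, b), x)" by (cases p) auto
      obtain a' b' x' where q_eq: "q = ((a', b'), x')" by (cases q) auto
      have in_: "a \<in> S" "x \<in> X" "a' \<in> S" "x' \<in> X" and eq: "\<Phi> ((a, b), x) = \<Phi> ((a', b'), x')"
        using pq p_eq q_eq by auto
      hence "level a b = level a' b'" and p: "x + axis k (a \<bullet> x + real b) = x' + axis k (a' \<bullet> x' + real b')"
        by (auto simp: \<Phi>_def)
      hence ab: "a = a'" "b = b'" using level_inj[of a b a' b' k] Sk in_ by blast+
      have "x = x'"
      proof (rule vec_eq_iff[THEN iffD2], rule allI)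
        fix i
        show "x $ i = x' $ i"
        proof (cases "i = k")
          case True
          then show ?thesis using in_ Xk by simp
        next
          case False
          then show ?thesis using arg_cong[OF p, of "\<lambda>z. z $ i"] by (simp add: axis_def)
        qed
      qed
      thus "p = q" using ab p_eq q_eq by simp
    qed
    have "\<Phi> ` ((S \<times> {..<N * M}) \<times> X) \<subseteq> incidences P H"
    proof
      fix w assume "w \<in> \<Phi> ` ((S \<times> {..<N * M}) \<times> X)"
      then obtain a b x where ab: "a \<in> S" "b < N * M" "x \<in> X" and w: "w = \<Phi> ((a, b), x)" by auto
      have "a \<in> grid k (-1) N" "x \<in> grid k 0 M" using S X ab by blast+
      then obtain y where y: "a \<bullet> x = real y" "y \<le> (CARD('n) - 1) * (N * M)" by (rule inner_grid_bound)
      \<comment> \<open>Inner products are at most (d-1) N M and offsets are below N M; hence the d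
        N M heights over each base point.\<close>
      have "CARD('n) * (N * M) = (CARD('n) - 1) * (N * M) + N * M"
        using zero_less_card_finite[where 'a = 'n] by (cases "CARD('n)") auto
      hence "y + b < CARD('n) * (N * M)" using y ab by linarith
      hence "x + axis k (real (y + b)) \<in> P" unfolding P_def using ab by (intro image_eqI[of _ _ "(x, y + b)"]) auto
      moreover have "level a b \<in> H" unfolding H_def using ab by (intro image_eqI[of _ _ "(a, b)"]) auto
      moreover have "x + axis k (a \<bullet> x + real b) \<in> level a b" using inc[OF ab(1)] by simp
      ultimately show "w \<in> incidences P H" using y(1) by (simp add: w \<Phi>_def incidences_def)
    qed
    hence "card ((S \<times> {..<N * M}) \<times> X) \<le> card (incidences P H)"
      using inj finite_incidences[OF finP finH] by (intro card_inj_on_le)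
    thus ?thesis by (simp add: num_incidences_def card_cartesian_product)
  qed
  ultimately show ?thesis using finP finH sl cP cH unfolding sloped_config_def
    by - (rule exI[of _ P], rule exI[of _ H], simp)
qed

section \<open>Sets evading flats of codimension two\<close>

lemma card_colourings_zero_on:
  assumes "finite V" "B \<subseteq> V" "0 < Q"
  shows "card {f \<in> V \<rightarrow>\<^sub>E {..<Q :: nat}. \<forall>v\<in>B. f v = 0} = Q ^ (card V - card B)"
proof -
  have "{f \<in> V \<rightarrow>\<^sub>E {..<Q}. \<forall>v\<in>B. f v = 0} = PiE V (\<lambda>v. if v \<in> B then {0} else {..<Q})"
  proof (rule set_eqI)
    fix f
    show "f \<in> {f \<in> V \<rightarrow>\<^sub>E {..<Q}. \<forall>v\<in>B. f v = 0} \<longleftrightarrow> f \<in> PiE V (\<lambda>v. if v \<in> B then {0} else {..<Q})"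
      using assms unfolding PiE_iff mem_Collect_eq by (intro iffI conjI ballI) (auto split: if_splits)
  qed
  also have "card \<dots> = (\<Prod>v\<in>V. if v \<in> B then 1 else Q)"
    using assms by (subst card_PiE) (auto intro!: prod.cong)
  also have "\<dots> = Q ^ card (V \<inter> - {v. v \<in> B})"
    using assms(1) by (simp add: prod.If_cases)
  also have "V \<inter> - {v. v \<in> B} = V - B" by blast
  also have "card (V - B) = card V - card B"
    using assms by (intro card_Diff_subset) (auto intro: finite_subset)
  finally show ?thesis .
qed

text \<open>Deletion method: keep each vertex with probability \<open>1/Q\<close>, i.e. keep the vertices of colour
  \<open>0\<close> in a random \<open>Q\<close>-colouring, and remove a vertex from every edge that survives.\<close>
lemma exists_large_independent_set:
  fixes V :: "'v set" and \<E> :: "'v set set"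
  assumes V: "finite V" and \<E>: "\<And>B. B \<in> \<E> \<Longrightarrow> B \<subseteq> V \<and> card B = t + 1"
    and Q: "0 < Q" "2 * card \<E> \<le> Q ^ t * card V"
  shows "\<exists>S\<subseteq>V. card V \<le> 2 * Q * card S \<and> (\<forall>B\<in>\<E>. \<not> B \<subseteq> S)"
proof -
  define F where "F = V \<rightarrow>\<^sub>E {..<Q}"
  define X where "X f = {v \<in> V. f v = 0}" for f :: "'v \<Rightarrow> nat"
  define Y where "Y f = {B \<in> \<E>. \<forall>v\<in>B. f v = 0}" for f :: "'v \<Rightarrow> nat"
  have fin\<E>: "finite \<E>" using \<E> V by (intro finite_subset[of \<E> "Pow V"]) auto
  have finF: "finite F" unfolding F_def using V by (intro finite_PiE) auto
  have cF: "card F = Q ^ card V" unfolding F_def using V by (simp add: card_PiE)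
  \<comment> \<open>Expectations are written as sums over all Q^|V| colourings, by double counting.
    On average |V|/Q vertices and |\<E>|/Q^(t+1) edges survive.\<close>
  have "(\<Sum>f\<in>F. real (card (X f))) = (\<Sum>f\<in>F. \<Sum>v\<in>V. if f v = 0 then 1 else 0)"
    using V by (intro sum.cong) (simp_all add: X_def sum.If_cases Int_def)
  also have "\<dots> = (\<Sum>v\<in>V. real (card {f\<in>F. \<forall>w\<in>{v}. f w = 0}))"
    using finF by (subst sum.swap) (simp add: sum.If_cases Int_def)
  also have "\<dots> = (\<Sum>v\<in>V. real (Q ^ (card V - 1)))"
  proof (rule sum.cong[OF refl])
    fix v assume "v \<in> V"
    hence "card {f\<in>F. \<forall>w\<in>{v}. f w = 0} = Q ^ (card V - card {v})"
      unfolding F_def using V Q by (intro card_colourings_zero_on) auto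
    thus "real (card {f\<in>F. \<forall>w\<in>{v}. f w = 0}) = real (Q ^ (card V - 1))" by simp
  qed
  finally have sX: "(\<Sum>f\<in>F. real (card (X f))) = real (card V) * real Q ^ (card V - 1)" by simp
  have "(\<Sum>f\<in>F. real (card (Y f))) = (\<Sum>f\<in>F. \<Sum>B\<in>\<E>. if \<forall>v\<in>B. f v = 0 then 1 else 0)"
    using fin\<E> by (intro sum.cong) (simp_all add: Y_def sum.If_cases Int_def)
  also have "\<dots> = (\<Sum>B\<in>\<E>. real (card {f\<in>F. \<forall>v\<in>B. f v = 0}))"
    using finF by (subst sum.swap) (simp add: sum.If_cases Int_def)
  also have "\<dots> = (\<Sum>B\<in>\<E>. real (Q ^ (card V - (t + 1))))"
  proof (rule sum.cong[OF refl])
    fix B assume "B \<in> \<E>"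
    thus "real (card {f\<in>F. \<forall>v\<in>B. f v = 0}) = real (Q ^ (card V - (t + 1)))"
      unfolding F_def using V Q \<E>[of B] by (subst card_colourings_zero_on) auto
  qed
  finally have sY: "(\<Sum>f\<in>F. real (card (Y f))) = real (card \<E>) * real Q ^ (card V - (t + 1))" by simp
  \<comment> \<open>By the size hypothesis, surviving edges average at most half of the surviving
    vertices. An existing edge forces t + 1 <= |V|, so that the subtractions in the exponents are
    not truncated.\<close>
  have "2 * (real (card \<E>) * real Q ^ (card V - (t + 1))) \<le> real (card V) * real Q ^ (card V - 1)"
  proof (cases "\<E> = {}")
    case False
    then obtain B where "B \<in> \<E>" by blast
    hence le: "t + 1 \<le> card V" using \<E>[of B] V card_mono by metis
    have "2 * real (card \<E>) \<le> real Q ^ t * real (card V)"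
      using Q(2) by (metis of_nat_le_iff of_nat_mult of_nat_numeral of_nat_power)
    hence "2 * real (card \<E>) * real Q ^ (card V - (t + 1))
        \<le> real Q ^ t * real (card V) * real Q ^ (card V - (t + 1))"
      by (rule mult_right_mono) simp
    also have "\<dots> = real (card V) * real Q ^ (t + (card V - (t + 1)))" by (simp add: power_add)
    also have "t + (card V - (t + 1)) = card V - 1" using le by simp
    finally show ?thesis by simp
  qed simp
  hence "(\<Sum>f\<in>F. real (card V) / (2 * real Q)) \<le> (\<Sum>f\<in>F. real (card (X f)) - real (card (Y f)))"
  proof -
    assume le: "2 * (real (card \<E>) * real Q ^ (card V - (t + 1))) \<le> real (card V) * real Q ^ (card V - 1)"
    have "(\<Sum>f\<in>F. real (card V) / (2 * real Q)) = real (card V) * (real Q ^ card V / real Q) / 2"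
      by (simp add: cF mult_ac)
    also have "\<dots> = real (card V) * real Q ^ (card V - 1) / 2"
      using Q(1) by (cases "card V") auto
    also have "\<dots> \<le> (\<Sum>f\<in>F. real (card (X f)) - real (card (Y f)))"
      unfolding sum_subtractf sX sY using le by simp
    finally show ?thesis .
  qed
  moreover have "F \<noteq> {}" using cF Q(1) by fastforce
  ultimately have "\<exists>f\<in>F. real (card V) / (2 * real Q) \<le> real (card (X f)) - real (card (Y f))"
    using sum_strict_mono[OF finF, of "\<lambda>f. real (card (X f)) - real (card (Y f))" "\<lambda>_. real (card V) / (2 * real Q)"]
    by (meson not_le)
  then obtain f where f: "f \<in> F" "real (card V) / (2 * real Q) \<le> real (card (X f)) - real (card (Y f))"
    by blast
  define r where "r B = (SOME v. v \<in> B)" for B :: "'v set"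
  have r: "r B \<in> B" if "B \<in> \<E>" for B
  proof -
    have "B \<noteq> {}" using \<E>[OF that] by auto
    thus ?thesis unfolding r_def by (rule some_in_eq[THEN iffD2])
  qed
  define S where "S = X f - r ` Y f"
  have finY: "finite (Y f)" using fin\<E> by (simp add: Y_def)
  have "card (X f) \<le> card S + card (r ` Y f)"
  proof -
    have "card (X f) \<le> card (S \<union> r ` Y f)" using V finY by (intro card_mono) (auto simp: S_def X_def)
    also have "\<dots> \<le> card S + card (r ` Y f)" by (rule card_Un_le)
    finally show ?thesis .
  qed
  also have "\<dots> \<le> card S + card (Y f)" using finY by (simp add: card_image_le)
  finally have "real (card (X f)) \<le> real (card S) + real (card (Y f))"
    by (simp flip: of_nat_add)
  hence "real (card V) / (2 * real Q) \<le> real (card S)" using f(2) by linarith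
  hence "real (card V) \<le> real (2 * Q * card S)" using Q(1) by (simp add: field_simps)
  hence "card V \<le> 2 * Q * card S" by (simp only: of_nat_le_iff)
  moreover have "\<not> B \<subseteq> S" if "B \<in> \<E>" for B
  proof
    assume "B \<subseteq> S"
    hence "B \<in> Y f" using that by (auto simp: Y_def S_def X_def)
    thus False using r[OF that] \<open>B \<subseteq> S\<close> by (auto simp: S_def)
  qed
  moreover have "S \<subseteq> V" by (auto simp: S_def X_def)
  ultimately show ?thesis by blast
qed

text \<open>Linear independence after deleting coordinate \<open>k\<close>, expressed by a nonzero
  2x2 minor: its indices are the coordinates for which the two equations of a flat can be
  solved.\<close>

definition transverse :: "'n \<Rightarrow> real ^ 'n::finite \<Rightarrow> real ^ 'n \<Rightarrow> bool" where
  "transverse k u u' \<longleftrightarrow> (\<exists>i j. i \<noteq> k \<and> j \<noteq> k \<and> u $ i * u' $ j \<noteq> u $ j * u' $ i)"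

text \<open>Cramer's rule recovers the coordinates \<open>i\<close> and \<open>j\<close> from the
  others, and coordinate \<open>k\<close> is constant, which leaves d - 3 free coordinates.\<close>

lemma card_grid_flat_le:
  fixes k :: "'n::finite" and u u' :: "real ^ 'n"
  assumes "transverse k u u'"
  shows "card {a \<in> grid k c N. a \<bullet> u = v \<and> a \<bullet> u' = v'} \<le> N ^ (CARD('n) - 3)"
proof -
  obtain i j where ij: "i \<noteq> k" "j \<noteq> k" and det: "u $ i * u' $ j \<noteq> u $ j * u' $ i"
    using assms by (auto simp: transverse_def)
  have neq: "i \<noteq> j" using det by auto
  define A where "A = {a \<in> grid k c N. a \<bullet> u = v \<and> a \<bullet> u' = v'}"
  define I where "I = UNIV - {k, i, j}"
  define \<phi> where "\<phi> a = restrict (\<lambda>l. a $ l) I" for a :: "real ^ 'n"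
  have "inj_on \<phi> A"
  proof (rule inj_onI)
    fix a a' assume a: "a \<in> A" "a' \<in> A" and eq: "\<phi> a = \<phi> a'"
    define w where "w = a - a'"
    have w0: "w $ l = 0" if "l \<noteq> i" "l \<noteq> j" for l
    proof (cases "l = k")
      case True
      then show ?thesis using a grid_nth_self[of a k c N] grid_nth_self[of a' k c N] by (simp add: A_def w_def)
    next
      case False
      hence "l \<in> I" using that by (simp add: I_def)
      thus ?thesis using fun_cong[OF eq, of l] by (simp add: \<phi>_def w_def)
    qed
    have inner_w: "w \<bullet> z = w $ i * z $ i + w $ j * z $ j" for z :: "real ^ 'n"
    proof -
      have "w \<bullet> z = (\<Sum>l\<in>UNIV. w $ l * z $ l)" by (simp add: inner_vec_def)
      also have "\<dots> = (\<Sum>l\<in>{i, j}. w $ l * z $ l)"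
        using w0 by (intro sum.mono_neutral_right) auto
      finally show ?thesis using neq by simp
    qed
    have "w \<bullet> u = 0" "w \<bullet> u' = 0" using a by (auto simp: A_def w_def inner_diff_left)
    hence e: "w $ i * u $ i + w $ j * u $ j = 0" "w $ i * u' $ i + w $ j * u' $ j = 0"
      by (simp_all add: inner_w)
    have "w $ i * (u $ i * u' $ j - u $ j * u' $ i)
        = (w $ i * u $ i + w $ j * u $ j) * u' $ j - (w $ i * u' $ i + w $ j * u' $ j) * u $ j"
      by (simp add: algebra_simps)
    hence "w $ i = 0" using det e by simp
    moreover have "w $ j * (u $ i * u' $ j - u $ j * u' $ i)
        = (w $ i * u' $ i + w $ j * u' $ j) * u $ i - (w $ i * u $ i + w $ j * u $ j) * u' $ i"
      by (simp add: algebra_simps)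
    hence "w $ j = 0" using det e by simp
    ultimately have "w $ l = 0" for l using w0 by (cases "l = i \<or> l = j") auto
    thus "a = a'" by (simp add: w_def vec_eq_iff)
  qed
  moreover have "\<phi> ` A \<subseteq> I \<rightarrow>\<^sub>E (real ` {..<N})"
  proof (rule image_subsetI)
    fix a assume "a \<in> A"
    hence "a \<in> grid k c N" by (simp add: A_def)
    then obtain f where f: "a = nat_vec k c f" "\<And>i. i \<noteq> k \<Longrightarrow> f i < N" by (rule gridE) blast
    show "\<phi> a \<in> I \<rightarrow>\<^sub>E (real ` {..<N})" unfolding \<phi>_def
      by (intro restrict_PiE_iff[THEN iffD2] ballI) (use f in \<open>auto simp: I_def\<close>)
  qed
  moreover have "finite (I \<rightarrow>\<^sub>E (real ` {..<N}))" by (intro finite_PiE) (auto simp: I_def)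
  ultimately have "card A \<le> card (I \<rightarrow>\<^sub>E (real ` {..<N}))" by (intro card_inj_on_le)
  also have "\<dots> = N ^ card I" by (simp add: card_PiE card_image inj_on_def)
  also have "card I = CARD('n) - 3" using ij neq by (simp add: I_def card_Diff_subset)
  finally show ?thesis by (simp add: A_def)
qed

text \<open>Each such set is the range of an r-tuple, a smaller set by repeating one of its
  elements.\<close>

lemma card_nonempty_subsets_le:
  assumes "finite A"
  shows "card {B. B \<subseteq> A \<and> B \<noteq> {} \<and> card B \<le> r} \<le> card A ^ r"
proof -
  have "{B. B \<subseteq> A \<and> B \<noteq> {} \<and> card B \<le> r} \<subseteq> (\<lambda>f. f ` {..<r}) ` ({..<r} \<rightarrow>\<^sub>E A)"
  proof
    fix B assume "B \<in> {B. B \<subseteq> A \<and> B \<noteq> {} \<and> card B \<le> r}"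
    hence B: "B \<subseteq> A" "B \<noteq> {}" "card B \<le> r" by auto
    have finB: "finite B" using B assms finite_subset by blast
    obtain h where h: "bij_betw h {0..<card B} B" using ex_bij_betw_nat_finite[OF finB] by blast
    obtain x where x: "x \<in> B" using B by blast
    define f where "f = restrict (\<lambda>i. if i < card B then h i else x) {..<r}"
    have hB: "h i \<in> B" if "i < card B" for i using bij_betwE[OF h] that by simp
    have "f ` {..<r} = B"
    proof
      show "f ` {..<r} \<subseteq> B" using hB x by (auto simp: f_def)
      show "B \<subseteq> f ` {..<r}"
      proof
        fix y assume "y \<in> B"
        then obtain i where "i < card B" "y = h i" using bij_betw_imp_surj_on[OF h] by (metis imageE atLeastLessThan_iff)
        thus "y \<in> f ` {..<r}" using B(3) by (intro image_eqI[of _ _ i]) (auto simp: f_def)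
      qed
    qed
    moreover have "f \<in> {..<r} \<rightarrow>\<^sub>E A" unfolding f_def
      by (intro restrict_PiE_iff[THEN iffD2] ballI) (use hB x B in auto)
    ultimately show "B \<in> (\<lambda>f. f ` {..<r}) ` ({..<r} \<rightarrow>\<^sub>E A)" by (intro image_eqI[of _ _ f]) simp_all
  qed
  hence "card {B. B \<subseteq> A \<and> B \<noteq> {} \<and> card B \<le> r} \<le> card ({..<r} \<rightarrow>\<^sub>E A)"
    using assms by (intro surj_card_le) (auto intro: finite_PiE)
  also have "\<dots> = card A ^ r" by (simp add: card_PiE)
  finally show ?thesis .
qed

text \<open>The edges for the deletion method: a set containing none of them has at most
  \<open>t\<close> points on each flat cut out by a transverse pair.\<close>

definition flat_subsets :: "'n \<Rightarrow> (real ^ 'n::finite) set \<Rightarrow> nat \<Rightarrow> (real ^ 'n) set set" where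
  "flat_subsets k G t = {T. T \<subseteq> G \<and> card T = t + 1 \<and>
     (\<exists>u u' v v'. transverse k u u' \<and> (\<forall>a\<in>T. a \<bullet> u = v \<and> a \<bullet> u' = v'))}"

text \<open>The points of such a set lie in the affine hull of at most \<open>d + 1\<close> of them.\<close>
lemma card_flat_subsets_le:
  fixes k :: "'n::finite"
  shows "card (flat_subsets k (grid k c N) t) \<le>
    (N ^ (CARD('n) - 1)) ^ (CARD('n) + 1) * (N ^ (CARD('n) - 3)) ^ (t + 1)"
proof -
  define G where "G = grid k c N"
  define r where "r = CARD('n) + 1"
  define \<B> where "\<B> = {B. B \<subseteq> G \<and> B \<noteq> {} \<and> card B \<le> r}"
  \<comment> \<open>Flats are infinite in number, so an edge is charged to an affine basis of
    itself. There are at most |G|^(d+1) of these, an exponent free of \<open>t\<close>, and the hull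
    of such a basis lies inside a flat, hence holds few grid points.\<close>
  define \<C> where "\<C> = {B \<in> \<B>. card (G \<inter> affine hull B) \<le> N ^ (CARD('n) - 3)}"
  define sub where "sub B = {T. T \<subseteq> G \<inter> affine hull B \<and> card T = t + 1}" for B
  have finG: "finite G" by (simp add: G_def)
  have fin\<B>: "finite \<B>" unfolding \<B>_def by (rule finite_subset[of _ "Pow G"]) (use finG in auto)
  have "flat_subsets k G t \<subseteq> (\<Union>B\<in>\<C>. sub B)"
  proof
    fix T assume "T \<in> flat_subsets k G t"
    then obtain u u' v v' where T: "T \<subseteq> G" "card T = t + 1" "transverse k u u'"
      and on: "\<And>a. a \<in> T \<Longrightarrow> a \<bullet> u = v \<and> a \<bullet> u' = v'" by (auto simp: flat_subsets_def)
    obtain B where B: "B \<subseteq> T" "\<not> affine_dependent B" "affine hull T = affine hull B"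
      using affine_basis_exists[of T] by blast
    have "int (card B) = aff_dim B + 1" using aff_dim_affine_independent[OF B(2)] by simp
    hence "card B \<le> r" using aff_dim_le_DIM[of B] by (simp add: r_def)
    moreover have "B \<noteq> {}"
    proof
      assume "B = {}"
      hence "affine hull T = {}" using B(3) by simp
      hence "T = {}" by simp
      thus False using T(2) by simp
    qed
    ultimately have B\<B>: "B \<in> \<B>" using B(1) T(1) by (auto simp: \<B>_def)
    define W where "W = {a. u \<bullet> a = v} \<inter> {a. u' \<bullet> a = v'}"
    have "affine W" unfolding W_def by (intro affine_Int affine_hyperplane)
    moreover have "B \<subseteq> W" using B(1) on by (auto simp: W_def inner_commute)
    ultimately have "affine hull B \<subseteq> W" by (intro hull_minimal)
    hence "G \<inter> affine hull B \<subseteq> {a \<in> G. a \<bullet> u = v \<and> a \<bullet> u' = v'}" by (auto simp: W_def inner_commute)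
    hence "card (G \<inter> affine hull B) \<le> card {a \<in> G. a \<bullet> u = v \<and> a \<bullet> u' = v'}"
      using finG by (intro card_mono) auto
    also have "\<dots> \<le> N ^ (CARD('n) - 3)" unfolding G_def by (rule card_grid_flat_le[OF T(3)])
    finally have "B \<in> \<C>" using B\<B> by (simp add: \<C>_def)
    moreover have "T \<in> sub B" using T(1,2) hull_subset[of T affine] B(3) by (auto simp: sub_def)
    ultimately show "T \<in> (\<Union>B\<in>\<C>. sub B)" by blast
  qed
  moreover have fin_sub: "finite (sub B)" for B
    unfolding sub_def by (rule finite_subset[of _ "Pow G"]) (use finG in auto)
  ultimately have "card (flat_subsets k G t) \<le> card (\<Union>B\<in>\<C>. sub B)"
    using fin\<B> by (intro card_mono) (auto simp: \<C>_def)
  also have "\<dots> \<le> (\<Sum>B\<in>\<C>. card (sub B))" using fin\<B> by (intro card_UN_le) (simp add: \<C>_def)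
  also have "\<dots> \<le> (\<Sum>B\<in>\<C>. (N ^ (CARD('n) - 3)) ^ (t + 1))"
  proof (rule sum_mono)
    fix B assume B: "B \<in> \<C>"
    have "card (sub B) = card (G \<inter> affine hull B) choose (t + 1)"
      unfolding sub_def using finG by (intro n_subsets) auto
    also have "\<dots> \<le> card (G \<inter> affine hull B) ^ (t + 1)"
      by (cases "t + 1 \<le> card (G \<inter> affine hull B)") (simp_all only: binomial_le_pow binomial_eq_0 not_le le0)
    also have "\<dots> \<le> (N ^ (CARD('n) - 3)) ^ (t + 1)"
      using B by (intro power_mono) (auto simp: \<C>_def)
    finally show "card (sub B) \<le> (N ^ (CARD('n) - 3)) ^ (t + 1)" .
  qed
  also have "\<dots> = card \<C> * (N ^ (CARD('n) - 3)) ^ (t + 1)" by simp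
  also have "card \<C> \<le> card \<B>" using fin\<B> by (intro card_mono) (auto simp: \<C>_def)
  also have "card \<B> \<le> card G ^ r" unfolding \<B>_def using finG by (rule card_nonempty_subsets_le)
  also have "card G = N ^ (CARD('n) - 1)" by (simp add: G_def card_grid)
  finally show ?thesis by (simp add: G_def r_def)
qed

lemma obtain_subset_card_le:
  assumes "finite A" "1 \<le> q"
  obtains B where "B \<subseteq> A" "card B \<le> q" "card A \<le> q \<Longrightarrow> B = A" "q \<le> card A \<Longrightarrow> card B = q"
proof (cases "card A \<le> q")
  case True
  show ?thesis by (rule that[of A]) (use True in auto)
next
  case False
  then obtain B where "B \<subseteq> A" "card B = q" using obtain_subset_with_card_n[of q A] by auto
  thus ?thesis using that[of B] False by auto
qed

text \<open>At density about N^(-(d-3+\<delta>)) a flat keeps about N^(-\<delta>) points on average,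
  so finding t + 1 of them there has probability about N^(-\<delta>(t+1)). For large
  \<open>t\<close> this outweighs the polynomial number of bases.\<close>

lemma evasive_subset:
  fixes k :: "'n::finite" and \<delta> :: real
  assumes d3: "3 \<le> CARD('n)" and \<delta>: "0 < \<delta>" "\<delta> \<le> 2"
  shows "\<exists>t\<ge>1. \<forall>N\<ge>1. \<exists>S\<subseteq>grid k (-1) N. real N powr (2 - \<delta>) / 6 \<le> real (card S) \<and>
    real (card S) \<le> real N powr (2 - \<delta>) \<and>
    (\<forall>u u' v v'. transverse k u u' \<longrightarrow> card {a \<in> S. a \<bullet> u = v \<and> a \<bullet> u' = v'} \<le> t)"
proof -
  define d where "d = CARD('n)"
  define D where "D = d - 1"
  \<comment> \<open>The edge count N^(D(d+1)+(d-3)(t+1)) must not exceed N^((d-3+\<delta>)t+D), that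
    is, D d + d - 3 <= \<delta> t. \<open>Suc\<close> ensures t >= 1, so that 2^t absorbs the factor
    2 of the deletion method.\<close>
  define t where "t = Suc (nat \<lceil>(D * d + d) / \<delta>\<rceil>)"
  have d: "3 \<le> d" "d = D + 1" "d - 3 + 2 = D" using d3 by (auto simp: d_def D_def)
  have t\<delta>: "real (D * d + d) \<le> \<delta> * real t"
  proof -
    have "real (D * d + d) / \<delta> \<le> real t" unfolding t_def by linarith
    thus ?thesis using \<delta> by (simp add: field_simps)
  qed
  have "\<exists>S\<subseteq>grid k (-1) N. real N powr (2 - \<delta>) / 6 \<le> real (card S) \<and> real (card S) \<le> real N powr (2 - \<delta>) \<and>
    (\<forall>u u' v v'. transverse k u u' \<longrightarrow> card {a \<in> S. a \<bullet> u = v \<and> a \<bullet> u' = v'} \<le> t)" if N: "1 \<le> N" for N :: nat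
  proof -
    define V where "V = grid k (-1) N"
    define \<E> where "\<E> = flat_subsets k V t"
    define x where "x = real N powr (real (d - 3) + \<delta>)"
    define Q where "Q = nat \<lceil>2 * x\<rceil>"
    have N1: "1 \<le> real N" using N by simp
    have x1: "1 \<le> x" unfolding x_def using N1 \<delta> by (intro ge_one_powr_ge_zero) auto
    have Q: "2 * x \<le> real Q" "real Q \<le> 3 * x"
    proof -
      show "2 * x \<le> real Q" unfolding Q_def by linarith
      have "real Q < 2 * x + 1" unfolding Q_def using x1 by linarith
      thus "real Q \<le> 3 * x" using x1 by linarith
    qed
    have cV: "card V = N ^ D" by (simp add: V_def card_grid D_def d_def)
    have cE: "card \<E> \<le> (N ^ D) ^ (d + 1) * (N ^ (d - 3)) ^ (t + 1)"
      unfolding \<E>_def V_def D_def d_def by (rule card_flat_subsets_le)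
    have "2 * real (card \<E>) \<le> real Q ^ t * real (card V)"
    proof -
      have "2 * real (card \<E>) \<le> 2 * real (N ^ (D * (d + 1) + (d - 3) * (t + 1)))"
        using cE by (simp add: power_add power_mult del: of_nat_power of_nat_mult)
      also have "\<dots> = 2 * real N powr (real (D * (d + 1) + (d - 3) * (t + 1)))"
        using N1 by (subst powr_realpow) auto
      also have "\<dots> \<le> 2 ^ t * real N powr ((real (d - 3) + \<delta>) * real t + real D)"
      proof (intro mult_mono powr_mono)
        have "(2::real) ^ 1 \<le> 2 ^ t" by (intro power_increasing) (auto simp: t_def)
        thus "(2::real) \<le> 2 ^ t" by simp
        have eq: "real (D * (d + 1) + g * (t + 1)) = real g * real t + real D + real (D * d + g)" for g
          by (simp add: algebra_simps)
        have "real (D * d + (d - 3)) \<le> real (D * d + d)" by simp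
        also note t\<delta>
        finally have "real (D * (d + 1) + (d - 3) * (t + 1)) \<le> real (d - 3) * real t + real D + \<delta> * real t"
          unfolding eq by simp
        thus "real (D * (d + 1) + (d - 3) * (t + 1)) \<le> (real (d - 3) + \<delta>) * real t + real D"
          by (simp add: algebra_simps)
      qed (use N1 in auto)
      also have "\<dots> = (2 * x) ^ t * real (card V)"
      proof -
        have "x ^ t = real N powr ((real (d - 3) + \<delta>) * real t)"
          using N1 by (simp add: x_def powr_powr flip: powr_realpow)
        moreover have "real (card V) = real N powr real D" using N1 by (simp add: cV powr_realpow)
        ultimately show ?thesis by (simp add: power_mult_distrib powr_add)
      qed
      also have "\<dots> \<le> real Q ^ t * real (card V)"
        using Q x1 by (intro mult_right_mono power_mono) auto
      finally show ?thesis .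
    qed
    hence "real (2 * card \<E>) \<le> real (Q ^ t * card V)" by simp
    hence "2 * card \<E> \<le> Q ^ t * card V" by (simp only: of_nat_le_iff)
    moreover have "0 < Q" using Q x1 by linarith
    moreover have "B \<subseteq> V \<and> card B = t + 1" if "B \<in> \<E>" for B using that by (auto simp: \<E>_def flat_subsets_def)
    ultimately obtain S where S: "S \<subseteq> V" "card V \<le> 2 * Q * card S" "\<And>B. B \<in> \<E> \<Longrightarrow> \<not> B \<subseteq> S"
      using exists_large_independent_set[of V \<E> t Q] by (auto simp: V_def)
    have finS: "finite S" using S(1) finite_subset[of S V] by (simp add: V_def)
    have flat: "card {a \<in> S. a \<bullet> u = v \<and> a \<bullet> u' = v'} \<le> t" if tr: "transverse k u u'" for u u' v v'
    proof (rule ccontr)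
      assume "\<not> ?thesis"
      then obtain T where T: "T \<subseteq> {a \<in> S. a \<bullet> u = v \<and> a \<bullet> u' = v'}" "card T = t + 1"
        using obtain_subset_with_card_n[of "t + 1" "{a \<in> S. a \<bullet> u = v \<and> a \<bullet> u' = v'}"] by auto
      have "T \<subseteq> S" and on: "\<forall>a\<in>T. a \<bullet> u = v \<and> a \<bullet> u' = v'" using T(1) by blast+
      have "\<exists>u u' v v'. transverse k u u' \<and> (\<forall>a\<in>T. a \<bullet> u = v \<and> a \<bullet> u' = v')"
        using tr on by (intro exI conjI)
      hence "T \<in> \<E>" using T(2) \<open>T \<subseteq> S\<close> S(1) by (simp add: \<E>_def flat_subsets_def)
      thus False using S(3) \<open>T \<subseteq> S\<close> by blast
    qed
    define z where "z = real N powr (2 - \<delta>)"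
    have z1: "1 \<le> z" unfolding z_def using N1 \<delta> by (intro ge_one_powr_ge_zero) auto
    have "real (card V) = x * z"
    proof -
      have "real (d - 3) + \<delta> + (2 - \<delta>) = real D" using d(3) by linarith
      hence "x * z = real N powr real D" unfolding x_def z_def by (simp flip: powr_add)
      thus ?thesis using N1 by (simp add: cV powr_realpow)
    qed
    moreover have "real (card V) \<le> real (2 * Q * card S)" using S(2) by (simp only: of_nat_le_iff)
    ultimately have "x * z \<le> 2 * real Q * real (card S)" by simp
    also have "\<dots> \<le> 2 * (3 * x) * real (card S)" using Q by (intro mult_right_mono mult_left_mono) auto
    finally have "x * z \<le> x * (6 * real (card S))" by simp
    hence zS: "z / 6 \<le> real (card S)" using x1 by simp
    \<comment> \<open>The set is trimmed since the number of hyperplanes needs an upper bound as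
      well; rounding down keeps at least z/2, so the bound z/6 survives.\<close>
    obtain q where q: "1 \<le> q" "real q \<le> z" "z / 2 \<le> real q" using floor_ge_half[OF z1] by blast
    obtain S' where S': "S' \<subseteq> S" "card S' \<le> q" "card S \<le> q \<Longrightarrow> S' = S" "q \<le> card S \<Longrightarrow> card S' = q"
      using obtain_subset_card_le[OF finS q(1)] by blast
    have "z / 6 \<le> real (card S')" using S'(3,4) zS q z1 by (cases "card S \<le> q") auto
    moreover have "real (card S') \<le> z" using S'(2) q(2) by linarith
    moreover have "card {a \<in> S'. a \<bullet> u = v \<and> a \<bullet> u' = v'} \<le> t" if "transverse k u u'" for u u' v v'
    proof -
      have "card {a \<in> S'. a \<bullet> u = v \<and> a \<bullet> u' = v'} \<le> card {a \<in> S. a \<bullet> u = v \<and> a \<bullet> u' = v'}"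
        using S'(1) finS by (intro card_mono) auto
      thus ?thesis using flat[OF that, of v v'] by (rule le_trans)
    qed
    moreover have "S' \<subseteq> grid k (-1) N" using S'(1) S(1) by (auto simp: V_def)
    ultimately show ?thesis unfolding z_def by blast
  qed
  moreover have "1 \<le> t" by (simp add: t_def)
  ultimately show ?thesis by blast
qed

section \<open>Lattice points on a sphere\<close>

text \<open>Pigeonhole: the M^(d-1) grid points share at most (d-1) M^2 + 1 <= d M^2 values of <x,
  x>. The fullest slices may be larger than M^(d-3) and are cut down to bound the number of points
  above.\<close>

lemma grid_sphere_slice:
  fixes k :: "'n::finite"
  assumes d3: "3 \<le> CARD('n)" and M: "1 \<le> M"
  shows "\<exists>X r. X \<subseteq> grid k 0 M \<and> (\<forall>x\<in>X. x \<bullet> x = r) \<and> card X \<le> M ^ (CARD('n) - 3) \<and>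
    M ^ (CARD('n) - 3) \<le> CARD('n) * card X"
proof -
  define d where "d = CARD('n)"
  define G where "G = grid k 0 M"
  define fibre where "fibre r = {x \<in> G. x \<bullet> x = real r}" for r
  have finG: "finite G" by (simp add: G_def)
  have "\<exists>r. M ^ (d - 3) \<le> d * card (fibre r)"
  proof (rule ccontr)
    assume "\<not> ?thesis"
    hence less: "d * card (fibre r) < M ^ (d - 3)" for r by (simp add: not_le)
    have "G \<subseteq> (\<Union>r\<in>{..(d - 1) * (M * M)}. fibre r)"
    proof
      fix x assume x: "x \<in> G"
      then obtain y where "x \<bullet> x = real y" "y \<le> (d - 1) * (M * M)"
        unfolding G_def d_def using inner_grid_bound[of x k 0 M x M] by blast
      thus "x \<in> (\<Union>r\<in>{..(d - 1) * (M * M)}. fibre r)" using x by (auto simp: fibre_def)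
    qed
    hence "card G \<le> card (\<Union>r\<in>{..(d - 1) * (M * M)}. fibre r)"
      using finG by (intro card_mono) (auto simp: fibre_def)
    also have "\<dots> \<le> (\<Sum>r\<in>{..(d - 1) * (M * M)}. card (fibre r))" by (intro card_UN_le) simp
    finally have "d * card G \<le> (\<Sum>r\<in>{..(d - 1) * (M * M)}. d * card (fibre r))"
      by (simp flip: sum_distrib_left)
    also have "\<dots> < (\<Sum>r\<in>{..(d - 1) * (M * M)}. M ^ (d - 3))"
      using less by (intro sum_strict_mono) auto
    also have "\<dots> = ((d - 1) * (M * M) + 1) * M ^ (d - 3)" by simp
    also have "\<dots> \<le> (d * (M * M)) * M ^ (d - 3)"
    proof (rule mult_right_mono)
      have "1 \<le> M * M" using M by simp
      moreover have "d * (M * M) = (d - 1) * (M * M) + M * M" using d3 by (cases d) (auto simp: d_def)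
      ultimately show "(d - 1) * (M * M) + 1 \<le> d * (M * M)" by linarith
    qed simp
    also have "\<dots> = d * M ^ (2 + (d - 3))" by (simp add: power_add power2_eq_square mult_ac)
    also have "2 + (d - 3) = d - 1" using d3 by (simp add: d_def)
    also have "M ^ (d - 1) = card G" by (simp add: G_def card_grid d_def)
    finally show False by simp
  qed
  then obtain r where r: "M ^ (d - 3) \<le> d * card (fibre r)" by blast
  have "finite (fibre r)" using finG by (simp add: fibre_def)
  moreover have "1 \<le> M ^ (d - 3)" using M by simp
  ultimately obtain X where X: "X \<subseteq> fibre r" "card X \<le> M ^ (d - 3)"
      "card (fibre r) \<le> M ^ (d - 3) \<Longrightarrow> X = fibre r" "M ^ (d - 3) \<le> card (fibre r) \<Longrightarrow> card X = M ^ (d - 3)"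
    using obtain_subset_card_le by blast
  have "M ^ (d - 3) \<le> d * card X"
  proof (cases "card (fibre r) \<le> M ^ (d - 3)")
    case False
    hence "card X = M ^ (d - 3)" using X(4) by simp
    thus ?thesis using d3 by (simp add: d_def)
  qed (use X(3) r in simp)
  thus ?thesis using X(1,2) unfolding d_def fibre_def G_def by (intro exI[of _ X] exI[of _ "real r"]) auto
qed

text \<open>A line meets a sphere in at most two points. The common coordinate \<open>k\<close>
  makes dependence outside \<open>k\<close> the same as dependence outright.\<close>

lemma transverse_of_sphere:
  fixes x x' x'' :: "real ^ 'n::finite"
  assumes "x \<bullet> x = r" "x' \<bullet> x' = r" "x'' \<bullet> x'' = r" and "x $ k = x' $ k" "x $ k = x'' $ k"
    and ne: "x \<noteq> x'" "x \<noteq> x''" "x' \<noteq> x''"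
  shows "transverse k (x - x') (x - x'')"
proof (rule ccontr)
  define u where "u = x - x'"
  define u' where "u' = x - x''"
  assume "\<not> ?thesis"
  hence "u $ i * u' $ j = u $ j * u' $ i" if "i \<noteq> k" "j \<noteq> k" for i j
    using that by (auto simp: transverse_def u_def u'_def)
  moreover have "u $ k = 0" "u' $ k = 0" using assms by (auto simp: u_def u'_def)
  ultimately have minors: "u $ i * u' $ j = u $ j * u' $ i" for i j by (cases "i = k"; cases "j = k") auto
  have "u \<noteq> 0" using ne by (simp add: u_def)
  then obtain l where l: "u $ l \<noteq> 0" by (auto simp: vec_eq_iff)
  define c where "c = u' $ l / u $ l"
  have u': "u' = c *\<^sub>R u" using minors[of l] l by (simp add: vec_eq_iff c_def field_simps)
  \<comment> \<open>This is |x - u| = |x|, and likewise for u' = c u. Comparing the two leaves c = 0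
    or c = 1, that is, x'' = x or x'' = x'.\<close>
  have "u \<bullet> u = 2 * (x \<bullet> u)" "u' \<bullet> u' = 2 * (x \<bullet> u')"
    using assms by (simp_all add: u_def u'_def inner_diff inner_commute)
  hence "c * (c - 1) * (u \<bullet> u) = 0" unfolding u' by (simp add: algebra_simps)
  hence "c = 0 \<or> c = 1" using \<open>u \<noteq> 0\<close> by simp
  thus False using u' ne by (auto simp: u_def u'_def)
qed

section \<open>The two block configurations\<close>

lemma moment_curve_subset:
  fixes k :: "'n::finite"
  assumes p: "prime p" and d2: "2 \<le> CARD('n)"
  shows "\<exists>S\<subseteq>grid k (-1) p. card S = p \<and> (\<forall>x\<in>grid k 0 M. \<forall>x'\<in>grid k 0 M. x \<noteq> x' \<longrightarrow>
    (\<forall>w. card {a \<in> S. a \<bullet> (x - x') = w} \<le> CARD('n) - 1))"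
proof -
  define I where "I = UNIV - {k}"
  have cI: "card I = card {1..CARD('n) - 1}" by (simp add: I_def card_Diff_singleton)
  obtain e where e: "bij_betw e I {1..CARD('n) - 1}"
    using finite_same_card_bij[OF _ _ cI] by (auto simp: I_def)
  define \<gamma> where "\<gamma> s = nat_vec k (-1) (\<lambda>i. s ^ e i mod p)" for s
  define S where "S = \<gamma> ` {..<p}"
  have p0: "0 < p" using p by (rule prime_gt_0_nat)
  \<comment> \<open>The coordinate with exponent 1 gives back the parameter s < p, so the curve has
    p distinct points.\<close>
  have "1 \<in> e ` I" using e d2 by (simp add: bij_betw_def)
  then obtain i where i: "i \<in> I" "e i = 1" by (metis imageE)
  have inj: "inj_on \<gamma> {..<p}"
  proof (rule inj_onI)
    fix s s' assume s: "s \<in> {..<p}" "s' \<in> {..<p}" "\<gamma> s = \<gamma> s'"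
    have "\<gamma> s $ i = \<gamma> s' $ i" by (simp only: s(3))
    thus "s = s'" using s(1,2) i by (simp add: \<gamma>_def I_def)
  qed
  have "card {a \<in> S. a \<bullet> (x - x') = w} \<le> CARD('n) - 1"
    if x: "x \<in> grid k 0 M" "x' \<in> grid k 0 M" "x \<noteq> x'" for x x' w
  proof -
    obtain f where f: "x = nat_vec k 0 f" using x(1) by (rule gridE)
    obtain f' where f': "x' = nat_vec k 0 f'" using x(2) by (rule gridE)
    define u where "u i = int (f i) - int (f' i)" for i
    have inner: "\<gamma> s \<bullet> (x - x') = of_int (\<Sum>i\<in>I. int (s ^ e i mod p) * u i)" for s
    proof -
      have "\<gamma> s \<bullet> (x - x') = x \<bullet> \<gamma> s - x' \<bullet> \<gamma> s" by (simp add: inner_diff_right inner_commute)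
      also have "\<dots> = real (\<Sum>i\<in>I. f i * (s ^ e i mod p)) - real (\<Sum>i\<in>I. f' i * (s ^ e i mod p))"
        unfolding f f' \<gamma>_def inner_nat_vec I_def ..
      also have "\<dots> = of_int (\<Sum>i\<in>I. int (s ^ e i mod p) * u i)"
        by (simp add: u_def sum_subtractf[symmetric] algebra_simps)
      finally show ?thesis .
    qed
    have "\<exists>i\<in>I. u i \<noteq> 0"
    proof (rule ccontr)
      assume "\<not> ?thesis"
      hence "x = x'" by (auto simp: f f' u_def I_def vec_eq_iff)
      thus False using x(3) by simp
    qed
    \<comment> \<open>The inner products are integers, so an attained real \<open>w\<close> equals
      its floor.\<close>
    have "{a \<in> S. a \<bullet> (x - x') = w} \<subseteq> \<gamma> ` {s. s < p \<and> (\<Sum>i\<in>I. int (s ^ e i mod p) * u i) = \<lfloor>w\<rfloor>}"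
    proof
      fix a assume "a \<in> {a \<in> S. a \<bullet> (x - x') = w}"
      then obtain s where s: "s < p" "a = \<gamma> s" "\<gamma> s \<bullet> (x - x') = w" by (auto simp: S_def)
      have "(\<Sum>i\<in>I. int (s ^ e i mod p) * u i) = \<lfloor>w\<rfloor>"
        unfolding s(3)[symmetric] inner by (rule floor_of_int[symmetric])
      thus "a \<in> \<gamma> ` {s. s < p \<and> (\<Sum>i\<in>I. int (s ^ e i mod p) * u i) = \<lfloor>w\<rfloor>}" using s by blast
    qed
    hence "card {a \<in> S. a \<bullet> (x - x') = w} \<le> card {s. s < p \<and> (\<Sum>i\<in>I. int (s ^ e i mod p) * u i) = \<lfloor>w\<rfloor>}"
      by (intro surj_card_le) auto
    also have "\<dots> \<le> CARD('n) - 1"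
      using p e \<open>\<exists>i\<in>I. u i \<noteq> 0\<close> by (intro card_moment_curve_hyperplane) (auto simp: I_def bij_betw_def)
    finally show ?thesis .
  qed
  moreover have "S \<subseteq> grid k (-1) p"
    unfolding S_def \<gamma>_def using p0 by (intro image_subsetI nat_vec_in_grid) simp
  moreover have "card S = p" using inj by (simp add: S_def card_image)
  ultimately show ?thesis by blast
qed

lemma moment_curve_block:
  fixes k :: "'n::finite" and \<delta> :: real
  assumes d2: "2 \<le> CARD('n)" and t: "CARD('n) - 1 \<le> t" and \<delta>: "0 < \<delta>"
  defines "d \<equiv> real CARD('n)"
  shows "\<exists>c>0. \<forall>N M. 1 \<le> N \<longrightarrow> 1 \<le> M \<longrightarrow>
      (\<exists>P H. sloped_config k 2 t P H \<and>
        real (card P) \<le> 4 * d * (real N * real M powr d) \<and> real (card H) \<le> 4 * d * (real N powr 2 * real M) \<and>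
        c * (real N powr (2 - \<delta>) * real M powr d) \<le> real (num_incidences P H))"
proof -
  \<comment> \<open>Slopes and offsets each contribute a factor p to the p^2 M^d incidences, so p
    may fall short of N by N^(\<delta>/2) only. The bound p <= 2N accounts for the 4 in the size
    estimates.\<close>
  obtain c where c: "0 < c"
    and prime: "\<And>N. 1 \<le> N \<Longrightarrow> \<exists>p. prime p \<and> c * real N powr (1 - \<delta> / 2) \<le> real p \<and> p \<le> 2 * N"
    using exists_prime_powr[of "\<delta> / 2"] \<delta> by (metis half_gt_zero)
  have "\<exists>P H. sloped_config k 2 t P H \<and>
      real (card P) \<le> 4 * d * (real N * real M powr d) \<and> real (card H) \<le> 4 * d * (real N powr 2 * real M) \<and>
      c\<^sup>2 * (real N powr (2 - \<delta>) * real M powr d) \<le> real (num_incidences P H)"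
    if N: "1 \<le> N" and M: "1 \<le> M" for N M
  proof -
    obtain p where p: "prime p" "c * real N powr (1 - \<delta> / 2) \<le> real p" "p \<le> 2 * N"
      using prime[OF N] by blast
    have p1: "1 \<le> p" using p(1) by (rule prime_ge_1_nat)
    obtain S :: "(real ^ 'n) set" where S: "S \<subseteq> grid k (-1) p" "card S = p"
      and S_deg: "\<And>x x' w. x \<in> grid k 0 M \<Longrightarrow> x' \<in> grid k 0 M \<Longrightarrow> x \<noteq> x' \<Longrightarrow>
        card {a \<in> S. a \<bullet> (x - x') = w} \<le> CARD('n) - 1"
      using moment_curve_subset[OF p(1) d2, of k M] by blast
    have finS: "finite S" using S(1) finite_subset finite_grid by blast
    have deg: "card {a \<in> S. \<exists>b. \<forall>x\<in>Y. a \<bullet> x + b = v x} \<le> t" if Y: "Y \<subseteq> grid k 0 M" "card Y = 2" for Y v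
    proof -
      obtain x x' where xx: "Y = {x, x'}" "x \<noteq> x'" using Y(2) by (auto simp: card_2_iff)
      have "{a \<in> S. \<exists>b. \<forall>x\<in>Y. a \<bullet> x + b = v x} \<subseteq> {a \<in> S. a \<bullet> (x - x') = v x - v x'}"
        by (auto simp: xx(1) inner_diff_right)
      hence "card {a \<in> S. \<exists>b. \<forall>x\<in>Y. a \<bullet> x + b = v x} \<le> card {a \<in> S. a \<bullet> (x - x') = v x - v x'}"
        using finS by (intro card_mono) auto
      also have "\<dots> \<le> CARD('n) - 1" using Y(1) xx by (intro S_deg) auto
      finally show ?thesis using t by linarith
    qed
    obtain P H where PH: "sloped_config k 2 t P H"
      "card P \<le> card (grid k 0 M) * (CARD('n) * (p * M))" "card H \<le> card S * (p * M)"
      "card S * (p * M) * card (grid k 0 M) \<le> num_incidences P H"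
      using lifted_grid_config[OF S(1) order_refl one_le_numeral p1 M deg] by blast
    have Md: "M ^ (CARD('n) - 1) * M = M ^ CARD('n)" using d2 by (simp add: power_eq_if)
    have Mpow: "real M powr d = real (M ^ CARD('n))" using M by (simp add: d_def powr_realpow)
    have "card P \<le> CARD('n) * (p * M ^ CARD('n))"
      using PH(2) by (simp add: card_grid Md[symmetric] mult_ac)
    also have "\<dots> \<le> CARD('n) * (2 * N * M ^ CARD('n))"
      using p(3) by (intro mult_left_mono mult_right_mono) auto
    also have "\<dots> \<le> 4 * CARD('n) * (N * M ^ CARD('n))" by simp
    finally have "real (card P) \<le> real (4 * CARD('n) * (N * M ^ CARD('n)))" by (simp only: of_nat_le_iff)
    hence P: "real (card P) \<le> 4 * d * (real N * real M powr d)" unfolding Mpow by (simp add: d_def)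
    have "card H \<le> (p * p) * M" using PH(3) S(2) by (simp add: mult_ac)
    also have "\<dots> \<le> (2 * N) * (2 * N) * M" using p(3) by (intro mult_right_mono mult_mono) auto
    also have "\<dots> \<le> 4 * CARD('n) * (N ^ 2 * M)" using d2 by (simp add: power2_eq_square)
    finally have "real (card H) \<le> real (4 * CARD('n) * (N ^ 2 * M))" by (simp only: of_nat_le_iff)
    hence H: "real (card H) \<le> 4 * d * (real N powr 2 * real M)" using N by (simp add: d_def)
    have "c\<^sup>2 * (real N powr (2 - \<delta>) * real M powr d) = (c * real N powr (1 - \<delta> / 2))\<^sup>2 * real M powr d"
    proof -
      have "real N powr (2 - \<delta>) = (real N powr (1 - \<delta> / 2))\<^sup>2"
        using powr_add[of "real N" "1 - \<delta> / 2" "1 - \<delta> / 2"] by (simp add: power2_eq_square)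
      thus ?thesis by (simp add: power_mult_distrib)
    qed
    also have "\<dots> \<le> (real p)\<^sup>2 * real M powr d"
      using p(2) c by (intro mult_right_mono power_mono) auto
    also have "\<dots> = real (card S * (p * M) * card (grid k 0 M))"
      unfolding Mpow Md[symmetric] by (simp add: S(2) card_grid power2_eq_square)
    also have "\<dots> \<le> real (num_incidences P H)" using PH(4) by (simp only: of_nat_le_iff)
    finally show ?thesis using PH(1) P H by blast
  qed
  moreover have "0 < c\<^sup>2" using c by simp
  ultimately show ?thesis by blast
qed

lemma sphere_block:
  fixes k :: "'n::finite" and \<delta>\<^sub>0 :: real
  assumes d4: "4 \<le> CARD('n)" and \<delta>\<^sub>0: "0 < \<delta>\<^sub>0" "\<delta>\<^sub>0 \<le> 2"
  defines "d \<equiv> real CARD('n)"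
  shows "\<exists>t\<^sub>0. \<forall>t\<ge>t\<^sub>0. \<forall>\<delta>>0. \<exists>c>0. \<forall>N M. 1 \<le> N \<longrightarrow> 1 \<le> M \<longrightarrow>
      (\<exists>P H. sloped_config k 3 t P H \<and>
        real (card P) \<le> d * (real N * real M powr (d - 2)) \<and>
        real (card H) \<le> d * (real N powr (3 - \<delta>\<^sub>0) * real M) \<and>
        c * (real N powr (3 - \<delta>\<^sub>0 - \<delta>) * real M powr (d - 2)) \<le> real (num_incidences P H))"
proof -
  have d3: "3 \<le> CARD('n)" using d4 by simp
  obtain t\<^sub>0 where evasive: "\<And>N. 1 \<le> N \<Longrightarrow> \<exists>S\<subseteq>grid k (-1) N. real N powr (2 - \<delta>\<^sub>0) / 6 \<le> real (card S) \<and>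
      real (card S) \<le> real N powr (2 - \<delta>\<^sub>0) \<and>
      (\<forall>u u' v v'. transverse k u u' \<longrightarrow> card {a \<in> S. a \<bullet> u = v \<and> a \<bullet> u' = v'} \<le> t\<^sub>0)"
    using evasive_subset[OF d3 \<delta>\<^sub>0, of k] by blast
  have d0: "1 \<le> d" using d4 by (simp add: d_def)
  have "\<exists>P H. sloped_config k 3 t P H \<and>
        real (card P) \<le> d * (real N * real M powr (d - 2)) \<and>
        real (card H) \<le> d * (real N powr (3 - \<delta>\<^sub>0) * real M) \<and>
        1 / (6 * d) * (real N powr (3 - \<delta>\<^sub>0 - \<delta>) * real M powr (d - 2)) \<le> real (num_incidences P H)"
    if t: "t\<^sub>0 \<le> t" and \<delta>: "0 < \<delta>" and N: "1 \<le> N" and M: "1 \<le> M" for t \<delta> N M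
  proof -
    obtain S :: "(real ^ 'n) set" where S: "S \<subseteq> grid k (-1) N" "real N powr (2 - \<delta>\<^sub>0) / 6 \<le> real (card S)"
        "real (card S) \<le> real N powr (2 - \<delta>\<^sub>0)"
      and S_deg: "\<And>u u' v v'. transverse k u u' \<Longrightarrow> card {a \<in> S. a \<bullet> u = v \<and> a \<bullet> u' = v'} \<le> t\<^sub>0"
      using evasive[OF N] by blast
    obtain X :: "(real ^ 'n) set" and r where X: "X \<subseteq> grid k 0 M" "\<And>x. x \<in> X \<Longrightarrow> x \<bullet> x = r"
        "card X \<le> M ^ (CARD('n) - 3)" "M ^ (CARD('n) - 3) \<le> CARD('n) * card X"
      using grid_sphere_slice[OF d3 M, of k] by blast
    have finS: "finite S" using S(1) finite_subset finite_grid by blast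
    have deg: "card {a \<in> S. \<exists>b. \<forall>x\<in>Y. a \<bullet> x + b = v x} \<le> t" if Y: "Y \<subseteq> X" "card Y = 3" for Y v
    proof -
      obtain x x' x'' where xx: "Y = {x, x', x''}" "x \<noteq> x'" "x \<noteq> x''" "x' \<noteq> x''"
        using Y(2) by (auto simp: card_3_iff)
      have in_X: "x \<in> X" "x' \<in> X" "x'' \<in> X" using xx(1) Y(1) by auto
      have zero: "z $ k = 0" if "z \<in> X" for z using X(1) that grid_nth_self by blast
      have "transverse k (x - x') (x - x'')"
        using in_X X(2) zero xx by (intro transverse_of_sphere[where r = r]) auto
      hence le: "card {a \<in> S. a \<bullet> (x - x') = v x - v x' \<and> a \<bullet> (x - x'') = v x - v x''} \<le> t\<^sub>0"
        by (rule S_deg)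
      have "{a \<in> S. \<exists>b. \<forall>x\<in>Y. a \<bullet> x + b = v x}
          \<subseteq> {a \<in> S. a \<bullet> (x - x') = v x - v x' \<and> a \<bullet> (x - x'') = v x - v x''}"
        by (auto simp: xx(1) inner_diff_right)
      hence "card {a \<in> S. \<exists>b. \<forall>x\<in>Y. a \<bullet> x + b = v x}
          \<le> card {a \<in> S. a \<bullet> (x - x') = v x - v x' \<and> a \<bullet> (x - x'') = v x - v x''}"
        using finS by (intro card_mono) auto
      thus ?thesis using le t by linarith
    qed
    obtain P H where PH: "sloped_config k 3 t P H"
      "card P \<le> card X * (CARD('n) * (N * M))" "card H \<le> card S * (N * M)"
      "card S * (N * M) * card X \<le> num_incidences P H"
      using lifted_grid_config[OF S(1) X(1) one_le_numeral N M deg] by blast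
    have Md: "M * M ^ (CARD('n) - 3) = M ^ (CARD('n) - 2)" 
    proof -
      have "CARD('n) - 2 = Suc (CARD('n) - 3)" using d4 by simp
      thus ?thesis by (simp only: power_Suc)
    qed
    have Mpow: "real M powr (d - 2) = real (M ^ (CARD('n) - 2))"
    proof -
      have "d - 2 = real (CARD('n) - 2)" using d4 by (simp add: d_def)
      thus ?thesis using M by (simp add: powr_realpow)
    qed
    have Npow: "real N powr (3 - \<delta>\<^sub>0) = real N powr (2 - \<delta>\<^sub>0) * real N"
      using N powr_add[of "real N" "2 - \<delta>\<^sub>0" 1] by simp
    have "card P \<le> M ^ (CARD('n) - 3) * (CARD('n) * (N * M))"
      using PH(2) X(3) by (elim order_trans) (rule mult_right_mono, auto)
    also have "\<dots> = CARD('n) * (N * M ^ (CARD('n) - 2))" by (simp flip: Md)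
    finally have "real (card P) \<le> real (CARD('n) * (N * M ^ (CARD('n) - 2)))" by (simp only: of_nat_le_iff)
    hence P: "real (card P) \<le> d * (real N * real M powr (d - 2))" unfolding Mpow by (simp add: d_def)
    have "real (card H) \<le> real (card S * (N * M))" using PH(3) by (simp only: of_nat_le_iff)
    also have "\<dots> \<le> real N powr (2 - \<delta>\<^sub>0) * (real N * real M)"
      unfolding of_nat_mult using S(3) by (intro mult_right_mono) auto
    also have "\<dots> \<le> d * (real N powr (3 - \<delta>\<^sub>0) * real M)"
      unfolding Npow mult.assoc[symmetric] using d0 mult_right_mono[OF d0, of "real N powr (2 - \<delta>\<^sub>0) * real N * real M"]
      by (simp add: mult_ac)
    finally have H: "real (card H) \<le> d * (real N powr (3 - \<delta>\<^sub>0) * real M)" .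
    have "real (M ^ (CARD('n) - 3)) \<le> real (CARD('n) * card X)" using X(4) by (simp only: of_nat_le_iff)
    hence cX: "real (M ^ (CARD('n) - 3)) / d \<le> real (card X)" using d0 by (simp add: d_def field_simps)
    have "real N powr (3 - \<delta>\<^sub>0 - \<delta>) \<le> real N powr (3 - \<delta>\<^sub>0)" using N \<delta> by (intro powr_mono) auto
    hence "1 / (6 * d) * (real N powr (3 - \<delta>\<^sub>0 - \<delta>) * real M powr (d - 2))
        \<le> 1 / (6 * d) * (real N powr (3 - \<delta>\<^sub>0) * real M powr (d - 2))"
      using d0 by (intro mult_left_mono mult_right_mono) auto
    also have "\<dots> = (real N powr (2 - \<delta>\<^sub>0) / 6) * (real N * real M) * (real (M ^ (CARD('n) - 3)) / d)"
      unfolding Mpow Md[symmetric] Npow by simp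
    also have "\<dots> \<le> real (card S) * (real N * real M) * real (card X)"
      using S(2) cX d0 by (intro mult_mono) auto
    also have "\<dots> = real (card S * (N * M) * card X)" by simp
    also have "\<dots> \<le> real (num_incidences P H)" using PH(4) by (simp only: of_nat_le_iff)
    finally show ?thesis using PH(1) P H by blast
  qed
  moreover have "0 < 1 / (6 * d)" using d0 by simp
  ultimately show ?thesis by blast
qed

section \<open>Matching the exponents\<close>

text \<open>With p = (x-1)(x-2) and \<delta> = 4/p, 3 - \<delta> = (3p-4)/p has numerator 3x^2 - 9x
  + 2, the quadratic of the claimed exponent.\<close>

lemma sphere_exponents:
  fixes x :: real
  assumes "4 \<le> x"
  defines "\<delta> \<equiv> 4 / ((x - 1) * (x - 2))"
  shows "0 < \<delta>" "\<delta> \<le> 2" "1 < 3 - \<delta>"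
    "(3 - \<delta>) * ((x - 2) - 1) / ((3 - \<delta>) * (x - 2) - 1) = (3 * x\<^sup>2 - 9 * x + 2) / ((x - 2) * (3 * x - 1))"
    "(x - 2) * ((3 - \<delta>) - 1) / ((3 - \<delta>) * (x - 2) - 1) = 2 * x / (3 * x - 1)"
proof -
  have "3 * 2 \<le> (x - 1) * (x - 2)" using assms by (intro mult_mono) auto
  hence \<delta>: "\<delta> \<le> 1" and "0 < \<delta>" by (auto simp: \<delta>_def field_simps)
  thus "0 < \<delta>" "\<delta> \<le> 2" "1 < 3 - \<delta>" by auto
  have nz: "x - 1 \<noteq> 0" "x - 2 \<noteq> 0" "x - 3 \<noteq> 0" "3 * x - 1 \<noteq> 0" using assms by auto
  define p where "p = (x - 1) * (x - 2)"
  have p: "p \<noteq> 0" using nz by (simp add: p_def)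
  have "3 - \<delta> = (3 * p - 4) / p" "3 - \<delta> - 1 = (2 * p - 4) / p"
    using p by (simp_all add: \<delta>_def field_simps flip: p_def)
  moreover have "3 * p - 4 = 3 * x\<^sup>2 - 9 * x + 2" "2 * p - 4 = 2 * x * (x - 3)"
    by (simp_all add: p_def algebra_simps power2_eq_square)
  ultimately have \<kappa>: "3 - \<delta> = (3 * x\<^sup>2 - 9 * x + 2) / ((x - 1) * (x - 2))"
    and 2: "3 - \<delta> - 1 = 2 * x * (x - 3) / ((x - 1) * (x - 2))"
    by (simp_all only: p_def)
  \<comment> \<open>The factor x - 3 cancels against e - 1 in the first exponent and against 2p - 4
    = 2x(x-3) in the second.\<close>
  have E: "(3 - \<delta>) * (x - 2) - 1 = (3 * x - 1) * (x - 3) / (x - 1)"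
  proof -
    have "(3 - \<delta>) * (x - 2) = (3 * x\<^sup>2 - 9 * x + 2) / (x - 1)" unfolding \<kappa> using nz by simp
    thus ?thesis using nz by (simp add: field_simps power2_eq_square)
  qed
  have cancel: "a / (p * q) * r / (s * r / p) = a / (q * s)" "q * (a * r / (p * q)) / (s * r / p) = a / s"
    if "p \<noteq> 0" "q \<noteq> 0" "r \<noteq> 0" "s \<noteq> 0" for a p q r s :: real
    using that by (simp_all add: field_simps)
  have 3: "x - 2 - 1 = x - 3" by simp
  show "(3 - \<delta>) * ((x - 2) - 1) / ((3 - \<delta>) * (x - 2) - 1) = (3 * x\<^sup>2 - 9 * x + 2) / ((x - 2) * (3 * x - 1))"
    unfolding E unfolding \<kappa> 3 using nz by (intro cancel(1))
  show "(x - 2) * ((3 - \<delta>) - 1) / ((3 - \<delta>) * (x - 2) - 1) = 2 * x / (3 * x - 1)"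
    unfolding E unfolding 2 using nz by (intro cancel(2))
qed

theorem theorem1p4:
  fixes d :: nat
  assumes dim: "d = CARD('n::finite)"
    and d_ge_2: "d \<ge> 2"
  shows "\<exists>t::nat. \<forall>\<epsilon>::real. \<epsilon> > 0 \<longrightarrow>
    (\<forall>A::real. A > 0 \<longrightarrow>
      (\<exists>b::real. b > 0 \<and>
        (\<forall>n m::nat. n > 0 \<longrightarrow> m > 0 \<longrightarrow> real m \<le> A * real n ^ d \<longrightarrow>
          (\<exists>(P :: (real ^ 'n) set) (H :: (real ^ 'n) set set).
            finite P \<and> card P = m \<and>
            finite H \<and> card H = n \<and> (\<forall>h\<in>H. hyperplane h) \<and>
            \<not> contains_K 2 (t + 1) P H \<and>
            real (num_incidences P H) \<ge>
              b * (real m powr ((2 * real d - 2) / (2 * real d - 1))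
                     * real n powr (real d / (2 * real d - 1) - \<epsilon>)
                   + real m + real n)))))
    \<and>
    (d \<ge> 4 \<longrightarrow>
      (\<forall>A::real. A > 0 \<longrightarrow>
        (\<exists>b::real. b > 0 \<and>
          (\<forall>n m::nat. n > 0 \<longrightarrow> m > 0 \<longrightarrow> real m \<le> A * real n ^ (d - 2) \<longrightarrow>
            (\<exists>(P :: (real ^ 'n) set) (H :: (real ^ 'n) set set).
              finite P \<and> card P = m \<and>
              finite H \<and> card H = n \<and> (\<forall>h\<in>H. hyperplane h) \<and>
              \<not> contains_K 3 (t + 1) P H \<and>
              real (num_incidences P H) \<ge>
                b * (real m powr ((3 * (real d)^2 - 9 * real d + 2)
                                    / ((real d - 2) * (3 * real d - 1)))
                       * real n powr (2 * real d / (3 * real d - 1) - \<epsilon>)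
                     + real m + real n))))))"
proof -
  have "\<exists>j k :: 'n. j \<noteq> k"
  proof (rule ccontr)
    assume "\<not> ?thesis"
    hence "CARD('n) \<le> 1" using card_le_Suc0_iff_eq[of "UNIV :: 'n set"] by simp
    thus False using dim d_ge_2 by simp
  qed
  \<comment> \<open>\<open>k\<close> carries the height; \<open>j\<close> is the second direction
    that padding uses.\<close>
  then obtain j k :: 'n where jk: "j \<noteq> k" by blast
  define \<delta> where "\<delta> = 4 / ((real d - 1) * (real d - 2))"
  \<comment> \<open>The existential stands outside the condition on \<open>d\<close>, so that
    \<open>t\<^sub>0\<close> is available, with an arbitrary value, also for d < 4.\<close>
  have "\<exists>t\<^sub>0. 4 \<le> d \<longrightarrow> (\<forall>t\<ge>t\<^sub>0. \<forall>\<eta>>0. \<exists>c>0. \<forall>N M. 1 \<le> N \<longrightarrow> 1 \<le> M \<longrightarrow>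
      (\<exists>P H. sloped_config k 3 t P H \<and>
        real (card P) \<le> real d * (real N * real M powr (real d - 2)) \<and>
        real (card H) \<le> real d * (real N powr (3 - \<delta>) * real M) \<and>
        c * (real N powr (3 - \<delta> - \<eta>) * real M powr (real d - 2)) \<le> real (num_incidences P H)))"
  proof (cases "4 \<le> d")
    case True
    hence "4 \<le> CARD('n)" "4 \<le> real d" using dim by simp_all
    thus ?thesis using sphere_block[of \<delta> k] sphere_exponents(1,2)[of "real d"] unfolding dim \<delta>_def by blast
  qed simp
  then obtain t\<^sub>0 where blocks_b: "4 \<le> d \<Longrightarrow> t\<^sub>0 \<le> t \<Longrightarrow> 0 < \<eta> \<Longrightarrow> \<exists>c>0. \<forall>N M. 1 \<le> N \<longrightarrow> 1 \<le> M \<longrightarrow>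
      (\<exists>P H. sloped_config k 3 t P H \<and>
        real (card P) \<le> real d * (real N * real M powr (real d - 2)) \<and>
        real (card H) \<le> real d * (real N powr (3 - \<delta>) * real M) \<and>
        c * (real N powr (3 - \<delta> - \<eta>) * real M powr (real d - 2)) \<le> real (num_incidences P H))" for t \<eta>
    by metis
  \<comment> \<open>\<open>d - 1\<close> serves the moment curve and \<open>t\<^sub>0\<close> the
    sphere; both blocks remain valid for a larger \<open>t\<close>.\<close>
  define t where "t = max t\<^sub>0 (d - 1)"
  have t: "t\<^sub>0 \<le> t" "CARD('n) - 1 \<le> t" "1 \<le> t" using dim d_ge_2 by (auto simp: t_def)
  have d2: "2 \<le> CARD('n)" using dim d_ge_2 by simp
  have d: "1 < real d" "0 < 4 * real d" "0 < real d" using d_ge_2 by simp_all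
  have a: "\<exists>b>0. \<forall>n m. 0 < n \<longrightarrow> 0 < m \<longrightarrow>
    (\<exists>(P :: (real ^ 'n) set) H. finite P \<and> card P = m \<and> finite H \<and> card H = n \<and> (\<forall>h\<in>H. hyperplane h) \<and>
      \<not> contains_K 2 (t + 1) P H \<and>
      real (num_incidences P H) \<ge> b * (real m powr ((2 * real d - 2) / (2 * real d - 1)) *
        real n powr (real d / (2 * real d - 1) - \<epsilon>) + real m + real n))" if \<epsilon>: "0 < \<epsilon>" for \<epsilon>
  proof -
    have "2 * (real d - 1) / (2 * real d - 1) = (2 * real d - 2) / (2 * real d - 1)"
      "real d * (2 - 1) / (2 * real d - 1) = real d / (2 * real d - 1)" by simp_all
    thus ?thesis
      using incidences_from_blocks[OF jk d(1) _ order_refl t(3) d(2) \<epsilon>, of 2]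
        moment_curve_block[OF d2 t(2), of _ k] unfolding dim[symmetric] by simp
  qed
  have b: "\<exists>b>0. \<forall>n m. 0 < n \<longrightarrow> 0 < m \<longrightarrow>
    (\<exists>(P :: (real ^ 'n) set) H. finite P \<and> card P = m \<and> finite H \<and> card H = n \<and> (\<forall>h\<in>H. hyperplane h) \<and>
      \<not> contains_K 3 (t + 1) P H \<and>
      real (num_incidences P H) \<ge> b * (real m powr ((3 * (real d)\<^sup>2 - 9 * real d + 2) / ((real d - 2) * (3 * real d - 1))) *
        real n powr (2 * real d / (3 * real d - 1) - \<epsilon>) + real m + real n))" if d4: "4 \<le> d" and \<epsilon>: "0 < \<epsilon>" for \<epsilon>
  proof -
    have 4: "4 \<le> real d" using d4 by simp
    note x = sphere_exponents[OF 4, folded \<delta>_def]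
    have "1 < real d - 2" "(2::nat) \<le> 3" using 4 by simp_all
    from incidences_from_blocks[OF jk this(1) x(3) this(2) t(3) d(3) \<epsilon> blocks_b[OF d4 t(1)]]
    show ?thesis unfolding x(4,5) .
  qed
  have drop: "\<exists>b>0. \<forall>n m. 0 < n \<longrightarrow> 0 < m \<longrightarrow> A n m \<longrightarrow> B b n m"
    if "\<exists>b>0. \<forall>n m. 0 < n \<longrightarrow> 0 < m \<longrightarrow> B b n m"
    for A :: "nat \<Rightarrow> nat \<Rightarrow> bool" and B :: "real \<Rightarrow> nat \<Rightarrow> nat \<Rightarrow> bool" using that by blast
  show ?thesis
  proof (rule exI[of _ t], intro allI impI conjI)
    fix \<epsilon> A :: real assume "0 < \<epsilon>"
    from a[OF this] show "\<exists>b>0. \<forall>n m. 0 < n \<longrightarrow> 0 < m \<longrightarrow> real m \<le> A * real n ^ d \<longrightarrow>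
          (\<exists>(P :: (real ^ 'n) set) (H :: (real ^ 'n) set set).
            finite P \<and> card P = m \<and>
            finite H \<and> card H = n \<and> (\<forall>h\<in>H. hyperplane h) \<and>
            \<not> contains_K 2 (t + 1) P H \<and>
            real (num_incidences P H) \<ge>
              b * (real m powr ((2 * real d - 2) / (2 * real d - 1))
                     * real n powr (real d / (2 * real d - 1) - \<epsilon>)
                   + real m + real n))" by (rule drop)
  next
    fix \<epsilon> A :: real assume "0 < \<epsilon>" "4 \<le> d"
    from b[OF this(2,1)] show "\<exists>b>0. \<forall>n m. 0 < n \<longrightarrow> 0 < m \<longrightarrow> real m \<le> A * real n ^ (d - 2) \<longrightarrow>
            (\<exists>(P :: (real ^ 'n) set) (H :: (real ^ 'n) set set).
              finite P \<and> card P = m \<and>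
              finite H \<and> card H = n \<and> (\<forall>h\<in>H. hyperplane h) \<and>
              \<not> contains_K 3 (t + 1) P H \<and>
              real (num_incidences P H) \<ge>
                b * (real m powr ((3 * (real d)^2 - 9 * real d + 2)
                                    / ((real d - 2) * (3 * real d - 1)))
                       * real n powr (2 * real d / (3 * real d - 1) - \<epsilon>)
                     + real m + real n))" by (rule drop)
  qed
qed

end
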